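(* Let $K$ be a field and $m\geq 1$. The Hilbert series of the product ideal of an arrangement of $m$ linear subspaces depends only on the dimensions $n_S$, $S\subseteq\{1,\dots,m\}$, of the intersections. That is: let $V_1,\dots,V_m$ be linear subspaces of a $K$-vector space $V$ and $V'_1,\dots,V'_m$ linear subspaces of a $K$-vector space $V'$, both ambient spaces of finite positive dimension, and suppose that $\dim\bigcap_{i\in S}V_i=\dim\bigcap_{i\in S}V'_i$ for all $S\subseteq\{1,\dots,m\}$ (for $S=\emptyset$ this means $\dim V=\dim V'$). Let $J=I_1\cdots I_m\subseteq K[V]$ and $J'=I'_1\cdots I'_m\subseteq K[V']$ be the products of the linear ideals of the $V_i$ and of the $V'_i$ respectively. Then $\mathcal{H}(J,t)=\mathcal{H}(J',t)$.
   Context: $K[V]$ is the polynomial coordinate ring of $V$ with its standard grading. The linear ideal of a subspace $W\subseteq V$ is the ideal of $K[V]$ generated by the linear forms vanishing on $W$ (this is the vanishing ideal of $W$ when $K$ is infinite). For a finitely generated graded module $M=\bigoplus_{d\in\mathbb{Z}} M_d$ over $K[V]$, the Hilbert series is $\mathcal{H}(M,t)=\sum_{d\in\mathbb{Z}}(\dim_K M_d)t^d$. *)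

theory Defs
  imports
    "HOL-Library.Poly_Mapping"
    "HOL-Algebra.Ideal_Product"
    "HOL-Computational_Algebra.Formal_Power_Series"
begin

text \<open>
  A finite-dimensional \<open>K\<close>-vector space \<open>V\<close> is the whole type \<open>'v\<close> with scalar multiplication
  \<open>scale\<close> and a basis \<open>B\<close>, as in the locale \<^locale>\<open>finite_dimensional_vector_space\<close>.  The
  coordinate ring \<open>K[V] = Sym(V*)\<close> is the polynomial ring whose variables are the coordinate
  functions of \<open>B\<close>; the variable dual to \<open>b \<in> B\<close> is named \<open>b\<close>.  Elements are formal polynomials
  (finitely supported maps from monomials to coefficients) and not functions on \<open>V\<close>, so finite
  fields are covered.
\<close>

type_synonym ('v, 'k) mpoly = "('v \<Rightarrow>\<^sub>0 nat) \<Rightarrow>\<^sub>0 'k"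

definition coord_ring :: "'v set \<Rightarrow> ('v, 'k::field) mpoly ring" where
  "coord_ring B =
     \<lparr>carrier = {p. \<forall>\<mu>\<in>Poly_Mapping.keys p. Poly_Mapping.keys \<mu> \<subseteq> B},
      monoid.mult = (*), one = 1, zero = 0, add = (+)\<rparr>"

text \<open>A functional \<open>\<phi>\<close> is \<open>\<Sum>b\<in>B. \<phi>(b) x\<^sub>b\<close> in terms of the dual basis.\<close>

definition linear_form :: "'v set \<Rightarrow> ('v \<Rightarrow> 'k) \<Rightarrow> ('v, 'k::field) mpoly" where
  "linear_form B \<phi> = (\<Sum>b\<in>B. Poly_Mapping.single (Poly_Mapping.single b 1) (\<phi> b))"

definition linear_ideal ::
    "('k::field \<Rightarrow> 'v::ab_group_add \<Rightarrow> 'v) \<Rightarrow> 'v set \<Rightarrow> 'v set \<Rightarrow> ('v, 'k) mpoly set" where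
  "linear_ideal scale B W =
     genideal (coord_ring B)
       {linear_form B \<phi> | \<phi>. Vector_Spaces.linear scale (*) \<phi> \<and> (\<forall>w\<in>W. \<phi> w = 0)}"

text \<open>\<open>I\<^sub>1 \<cdots> I\<^sub>m\<close>; the innermost factor is the unit ideal.\<close>

definition product_ideal ::
    "('k::field \<Rightarrow> 'v::ab_group_add \<Rightarrow> 'v) \<Rightarrow> 'v set \<Rightarrow> nat \<Rightarrow> (nat \<Rightarrow> 'v set)
      \<Rightarrow> ('v, 'k) mpoly set" where
  "product_ideal scale B m V =
     foldr (ideal_prod (coord_ring B)) (map (\<lambda>i. linear_ideal scale B (V i)) [1..<Suc m])
       (carrier (coord_ring B))"

definition monom_degree :: "('v \<Rightarrow>\<^sub>0 nat) \<Rightarrow> nat" where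
  "monom_degree \<mu> = (\<Sum>b\<in>Poly_Mapping.keys \<mu>. Poly_Mapping.lookup \<mu> b)"

definition graded_part :: "nat \<Rightarrow> ('v, 'k::field) mpoly set \<Rightarrow> ('v, 'k) mpoly set" where
  "graded_part d M = {p \<in> M. \<forall>\<mu>\<in>Poly_Mapping.keys p. monom_degree \<mu> = d}"

definition poly_scale :: "'k::field \<Rightarrow> ('v, 'k) mpoly \<Rightarrow> ('v, 'k) mpoly" where
  "poly_scale c p = Poly_Mapping.single 0 c * p"

text \<open>
  The Hilbert series of a homogeneous ideal \<open>M\<close> of \<open>K[V]\<close>, regarded as a graded submodule:
  \<open>M\<^sub>d = M \<inter> K[V]\<^sub>d\<close>.  Since \<open>M\<^sub>d = 0\<close> for \<open>d < 0\<close>, the sum over all integers is a power series.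
\<close>

definition hilbert_series :: "('v, 'k::field) mpoly set \<Rightarrow> int fps" where
  "hilbert_series M = Abs_fps (\<lambda>d. int (vector_space.dim poly_scale (graded_part d M)))"

lemma vector_space_poly_scale:
  "vector_space (poly_scale :: 'k::field \<Rightarrow> ('v, 'k) mpoly \<Rightarrow> ('v, 'k) mpoly)"
proof
  fix a b :: 'k and x y :: "('v, 'k) mpoly"
  show "poly_scale a (x + y) = poly_scale a x + poly_scale a y"
    by (simp add: poly_scale_def distrib_left)
  show "poly_scale (a + b) x = poly_scale a x + poly_scale b x"
    by (simp add: poly_scale_def single_add distrib_right)
  show "poly_scale a (poly_scale b x) = poly_scale (a * b) x"
    unfolding poly_scale_def by (simp only: mult.assoc[symmetric] mult_single add_0)
  show "poly_scale 1 x = x"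
    by (simp add: poly_scale_def)
qed

lemma cring_coord_ring: "cring (coord_ring B :: ('v, 'k::field) mpoly ring)"
proof -
  let ?P = "{p :: ('v, 'k) mpoly. \<forall>\<mu>\<in>Poly_Mapping.keys p. Poly_Mapping.keys \<mu> \<subseteq> B}"
  have add: "p + q \<in> ?P" if "p \<in> ?P" "q \<in> ?P" for p q
    using that keys_add[of p q] by blast
  have mult: "p * q \<in> ?P" if "p \<in> ?P" "q \<in> ?P" for p q
  proof (intro CollectI ballI)
    fix \<mu> assume "\<mu> \<in> Poly_Mapping.keys (p * q)"
    then obtain a b where "\<mu> = a + b" "a \<in> Poly_Mapping.keys p" "b \<in> Poly_Mapping.keys q"
      using keys_mult[of p q] by auto
    with that show "Poly_Mapping.keys \<mu> \<subseteq> B" using keys_add[of a b] by blast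
  qed
  have neg: "- p \<in> ?P" if "p \<in> ?P" for p
    using that by (simp add: in_keys_iff)
  have zero: "0 \<in> ?P" and one: "1 \<in> ?P" by simp_all
  have car: "carrier (coord_ring B) = ?P"
    and ops: "x \<oplus>\<^bsub>coord_ring B\<^esub> y = x + y" "x \<otimes>\<^bsub>coord_ring B\<^esub> y = x * y"
      "\<zero>\<^bsub>coord_ring B\<^esub> = 0" "\<one>\<^bsub>coord_ring B\<^esub> = 1" for x y :: "('v, 'k) mpoly"
    by (simp_all add: coord_ring_def)
  have "abelian_group (coord_ring B :: ('v, 'k) mpoly ring)"
  proof (rule abelian_groupI, unfold ops car)
    fix x y z :: "('v, 'k) mpoly"
    show "0 \<in> ?P" by (rule zero)
    show "0 + x = x" by (rule add_0)
    show "x + y + z = x + (y + z)" by (rule add.assoc)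
    show "x + y = y + x" by (rule add.commute)
    assume x: "x \<in> ?P"
    show "\<exists>y\<in>?P. y + x = 0" by (rule bexI[OF _ neg[OF x]]) (rule add.left_inverse)
    assume "y \<in> ?P"
    with x show "x + y \<in> ?P" by (rule add)
  qed
  moreover have "comm_monoid (coord_ring B :: ('v, 'k) mpoly ring)"
  proof (rule comm_monoidI, unfold ops car)
    fix x y z :: "('v, 'k) mpoly"
    show "1 \<in> ?P" by (rule one)
    show "1 * x = x" by (rule mult_1)
    show "x * y * z = x * (y * z)" by (rule mult.assoc)
    show "x * y = y * x" by (rule mult.commute)
    assume "x \<in> ?P" "y \<in> ?P"
    then show "x * y \<in> ?P" by (rule mult)
  qed
  ultimately show ?thesis
    by (rule cringI) (simp only: ops distrib_right)
qed

lemma linear_form_in_carrier: "linear_form B \<phi> \<in> carrier (coord_ring B)"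
proof -
  have "Poly_Mapping.keys \<mu> \<subseteq> B" if \<mu>: "\<mu> \<in> Poly_Mapping.keys (linear_form B \<phi>)" for \<mu>
  proof -
    have "(\<Sum>b\<in>B. Poly_Mapping.lookup (Poly_Mapping.single (Poly_Mapping.single b 1) (\<phi> b)) \<mu>) \<noteq> 0"
      using \<mu> by (simp add: linear_form_def in_keys_iff lookup_sum)
    then obtain b where "b \<in> B"
      "Poly_Mapping.lookup (Poly_Mapping.single (Poly_Mapping.single b (1::nat)) (\<phi> b)) \<mu> \<noteq> 0"
      by (meson sum.neutral)
    then show ?thesis by (auto simp: lookup_single when_def split: if_splits)
  qed
  then show ?thesis by (simp add: coord_ring_def)
qed

lemma ideal_linear_ideal: "ideal (linear_ideal scale B W) (coord_ring B)"
proof -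
  interpret cring "coord_ring B" by (rule cring_coord_ring)
  show ?thesis unfolding linear_ideal_def
    by (rule genideal_ideal) (auto intro: linear_form_in_carrier)
qed

lemma ideal_product_ideal: "ideal (product_ideal scale B m V) (coord_ring B)"
proof -
  interpret cring "coord_ring B" by (rule cring_coord_ring)
  have "ideal (foldr (ideal_prod (coord_ring B)) (map (\<lambda>i. linear_ideal scale B (V i)) xs)
          (carrier (coord_ring B))) (coord_ring B)" for xs
    by (induction xs) (simp_all add: oneideal ideal_prod_is_ideal ideal_linear_ideal)
  then show ?thesis unfolding product_ideal_def .
qed

end

theory Submission
  imports Defs "HOL-Library.Function_Algebras" "HOL-Computational_Algebra.Polynomial_Factorial"
begin

text \<open>
  The linear ideal of \<open>V\<^sub>i\<close> is generated by the space \<open>L\<^sub>i\<close> of linear forms vanishing on \<open>V\<^sub>i\<close>, and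
  \<open>\<Sum>\<^sub>i\<^sub>\<in>\<^sub>A L\<^sub>i\<close> has dimension \<open>n - dim (\<Inter>\<^sub>i\<^sub>\<in>\<^sub>A V\<^sub>i)\<close>.  So the two arrangements give two families of
  spaces of forms with the same rank function \<open>A \<mapsto> dim (\<Sum>\<^sub>i\<^sub>\<in>\<^sub>A L\<^sub>i)\<close>, and the Hilbert function of
  \<open>J = (L\<^sub>1) \<cdots> (L\<^sub>m)\<close> has to be computed from the rank function.

  Suppose that the field is infinite and that \<open>L\<^sub>1 \<noteq> 0\<close>, as \<open>J = 0\<close> otherwise.
  Call \<open>x \<in> L\<^sub>1\<close> generic if it lies in \<open>\<Sum>\<^sub>i\<^sub>\<in>\<^sub>A L\<^sub>i\<close> only for those
  \<open>A\<close> for which all of \<open>L\<^sub>1\<close> does.  The decisive fact is that then \<open>(J : x) = (L\<^sub>2) \<cdots> (L\<^sub>m)\<close>.  It gives an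
  exact sequence from \<open>(L\<^sub>2) \<cdots> (L\<^sub>m)\<close>, shifted by one degree, through \<open>J\<close> to the image of \<open>J\<close> modulo \<open>x\<close>.
  Both outer terms are again products of linear ideals, one with fewer factors and one with fewer
  variables, and genericity expresses their rank functions by the one of the \<open>L\<^sub>i\<close>.  Hence an
  induction determines the Hilbert function.  Instead of passing to quotient rings, the induction
  carries along a space \<open>P\<close> of forms and deals with \<open>J + (P)\<close>: see \<open>dim_sum_part_recursion\<close> and
  \<open>dim_sum_part_cong\<close>.

  The colon ideal is computed from the primary decomposition of Conca and Herzog: \<open>f \<in> J\<close> as soon
  as, for all \<open>A\<close>, \<open>f\<close> vanishes to order \<open>|A|\<close> along the common zeros of the \<open>L\<^sub>i\<close> with \<open>i \<in> A\<close>
  (\<open>in_sum_part_if_vanishing\<close>).  The same generic \<open>x\<close> proves it.  By induction on the number of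
  variables \<open>f\<close> lies in \<open>J\<close> modulo \<open>x\<close>, so \<open>f = j + x g\<close> with \<open>j \<in> J\<close>, and \<open>x g\<close> satisfies the vanishing
  conditions as well.  Cancelling \<open>x\<close> costs no order for those \<open>A\<close> with \<open>x \<notin> \<Sum>\<^sub>i\<^sub>\<in>\<^sub>A L\<^sub>i\<close>.  For the other
  \<open>A \<subseteq> {2, \<dots>, m}\<close> it costs one, but there \<open>A\<close> and \<open>A \<union> {1}\<close> have the same common zeros and the condition
  for \<open>A \<union> {1}\<close> has one order to spare (\<open>vanishing_cancel_generic\<close>).  So \<open>g\<close> satisfies the
  conditions for \<open>L\<^sub>2, \<dots>, L\<^sub>m\<close>, and by induction on the number of factors \<open>x g \<in> J\<close>.

  An arbitrary field \<open>K\<close> is replaced by the infinite field \<open>K(t)\<close>, which does not change the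
  dimension of the span of a set defined over \<open>K\<close> (\<open>dim_span_evaluate_image\<close>).  Over an infinite field
  polynomials are functions.  Orders of vanishing can then be read off on lines, and evaluation
  takes the place of linear changes of coordinates.
\<close>

section \<open>Finite-dimensional subspaces of a vector space\<close>

context vector_space
begin

lemma dim_insert_notin_span:
  assumes "x \<notin> span S" "S \<subseteq> span F" "finite F"
  shows "dim (insert x S) = dim S + 1"
proof -
  obtain C where C: "C \<subseteq> S" "independent C" "S \<subseteq> span C"
    using maximal_independent_subset by blast
  have spC: "span C = span S"
    using C by (simp add: span_mono span_minimal subset_antisym)
  have "finite C"
    using independent_span_bound[OF assms(3) C(2)] C(1) assms(2) by blast
  moreover have "independent (insert x C)"
    using independent_insertI[OF _ C(2)] assms(1) spC by simp
  moreover have "x \<notin> C" using assms(1) C(1) span_base by blast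
  moreover have "span (insert x C) = span (insert x S)"
    using spC by (simp add: span_insert)
  then have "dim (insert x S) = dim (insert x C)"
    by (rule span_eq_dim[symmetric])
  ultimately show ?thesis
    using C basis_card_eq_dim[of C S] by (simp add: dim_eq_card_independent)
qed

lemma dim_mono_finite_span:
  assumes "V \<subseteq> span W" "W \<subseteq> span F" "finite F"
  shows "dim V \<le> dim W"
proof -
  obtain C where C: "C \<subseteq> V" "independent C" "V \<subseteq> span C"
    using maximal_independent_subset by blast
  obtain D where D: "D \<subseteq> W" "independent D" "W \<subseteq> span D"
    using maximal_independent_subset by blast
  have finD: "finite D" using independent_span_bound[OF assms(3) D(2)] D(1) assms(2) by blast
  have "C \<subseteq> span D" using C(1) assms(1) D(3) span_minimal[OF D(3)] by auto
  then have "card C \<le> card D" using independent_span_bound[OF finD C(2)] by blast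
  then show ?thesis using basis_card_eq_dim[OF C(1) C(3) C(2)] basis_card_eq_dim[OF D(1) D(3) D(2)] by simp
qed

lemma span_Un_span_right: "span (A \<union> span C) = span (A \<union> C)"
  by (simp only: span_Un span_span)

lemma span_Un_span_left: "span (span A \<union> C) = span (A \<union> C)"
  by (simp only: span_Un span_span)

text \<open>
  Rank-nullity for the map \<open>E \<rightarrow> V / M\<close> induced by \<open>T\<close>, stated without the quotient \<open>V / M\<close>.  The
  ambient space may have infinite dimension, as spaces of functions do.
\<close>
lemma dim_preimage_add_dim_image:
  assumes T: "Vector_Spaces.linear scale scale T"
    and M: "subspace M" "M \<subseteq> span F" "finite F"
    and E: "subspace E" "E \<subseteq> span G" "finite G"
  shows "dim (span (M \<union> T ` E)) + dim {g \<in> E. T g \<in> M} = dim M + dim E"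
proof -
  interpret T: Vector_Spaces.linear scale scale T by (rule T)
  let ?N = "{g \<in> E. T g \<in> M}"
  have N: "subspace ?N"
    using subspace_inter[OF E(1) T.subspace_linear_preimage[OF M(1)]]
    by (simp add: Int_def)
  obtain C where C: "C \<subseteq> ?N" "independent C" "?N \<subseteq> span C"
    using maximal_independent_subset by blast
  have spC: "span C = ?N" using C N by (simp add: span_subspace)
  obtain D where D: "C \<subseteq> D" "D \<subseteq> E" "independent D" "E \<subseteq> span D"
    using maximal_independent_subset_extend[of C E] C by blast
  have finD: "finite D"
    using independent_span_bound[OF E(3) D(3)] D(2) E(2) by blast
  \<comment> \<open>\<open>T\<close> maps the basis vectors of \<open>E\<close> outside the kernel to vectors independent modulo \<open>M\<close>.\<close>
  have step: "dim (span (M \<union> T ` A)) = dim M + card A" if "A \<subseteq> D - C" for A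
    using finite_subset[OF that finite_Diff[OF finD]] that
  proof (induction A rule: finite_induct)
    case empty
    then show ?case by (simp add: M(1))
  next
    case (insert a A)
    have "T a \<notin> span (M \<union> T ` A)"
    proof
      assume "T a \<in> span (M \<union> T ` A)"
      then obtain m w where mw: "m \<in> M" "w \<in> span A" "T a = m + T w"
        unfolding span_Un T.span_image span_eq_iff[THEN iffD2, OF M(1)] by blast
      have "T (a - w) \<in> M" using mw by (simp add: T.diff)
      moreover have "a - w \<in> E"
      proof (rule subspace_diff[OF E(1)])
        show "a \<in> E" using insert.prems D(2) by blast
        have "A \<subseteq> E" using insert.prems D(2) by blast
        then show "w \<in> E" using mw(2) span_minimal[OF _ E(1)] by blast
      qed
      ultimately have "a - w \<in> span C" using spC by simp
      moreover have "span C \<subseteq> span (D - {a})" "span A \<subseteq> span (D - {a})"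
        using insert.prems insert.hyps D(1) by (auto intro!: span_mono)
      ultimately have "a - w + w \<in> span (D - {a})"
        using mw(2) span_add by blast
      then show False using D(3) insert.prems dependent_def by auto
    qed
    moreover have "M \<union> T ` A \<subseteq> span (F \<union> T ` A)"
      using M(2) span_mono[of F "F \<union> T ` A"] span_superset[of "F \<union> T ` A"] by blast
    ultimately have "dim (insert (T a) (M \<union> T ` A)) = dim (M \<union> T ` A) + 1"
      using M(3) insert.hyps by (intro dim_insert_notin_span[where F="F \<union> T ` A"]) auto
    then show ?case using insert by simp
  qed
  have "span (M \<union> T ` E) = span (M \<union> T ` (D - C))"
  proof
    have "T ` E \<subseteq> span (M \<union> T ` (D - C))"
    proof -
      have "T ` D \<subseteq> span (M \<union> T ` (D - C))"
        using C(1) by (auto intro: span_base)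
      then have "span (T ` D) \<subseteq> span (M \<union> T ` (D - C))" by (simp add: span_minimal)
      then show ?thesis using D(4) unfolding T.span_image by blast
    qed
    moreover have "M \<subseteq> span (M \<union> T ` (D - C))"
      using span_superset by blast
    ultimately show "span (M \<union> T ` E) \<subseteq> span (M \<union> T ` (D - C))"
      by (intro span_minimal) auto
    show "span (M \<union> T ` (D - C)) \<subseteq> span (M \<union> T ` E)"
      using D(2) by (intro span_mono) auto
  qed
  moreover have "dim ?N = card C" "dim E = card D"
    using basis_card_eq_dim[OF C(1) C(3) C(2)] basis_card_eq_dim[OF D(2) D(4) D(3)] by simp_all
  moreover have "card (D - C) + card C = card D"
    using D(1) finD 
    by (simp add: card_Diff_subset card_mono finite_subset)
  ultimately show ?thesis using step[of "D - C"] by simp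
qed

text \<open>
  A vector space over an infinite field is not a finite union of proper subspaces: if \<open>x\<close> is good for
  all \<open>U \<in> \<U>\<close> and \<open>y \<in> L\<close> lies outside the new subspace \<open>U\<^sub>0\<close>, then a line \<open>y + c x\<close> with \<open>x \<in> U\<^sub>0\<close> avoids \<open>U\<^sub>0\<close>
  and meets each relevant \<open>U\<close> at most once.
\<close>
lemma exists_generic_vector:
  assumes inf: "infinite (UNIV :: 'a set)" and L: "subspace L"
    and fin: "finite \<U>" and sub: "\<And>U. U \<in> \<U> \<Longrightarrow> subspace U"
  shows "\<exists>x\<in>L. \<forall>U\<in>\<U>. x \<in> U \<longrightarrow> L \<subseteq> U"
  using fin sub
proof (induction \<U> rule: finite_induct)
  case empty
  then show ?case using subspace_0[OF L] by blast
next
  case (insert U0 \<U>)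
  then obtain x where x: "x \<in> L" "\<And>U. U \<in> \<U> \<Longrightarrow> x \<in> U \<Longrightarrow> L \<subseteq> U" by auto
  show ?case
  proof (cases "x \<in> U0 \<and> \<not> L \<subseteq> U0")
    case False
    then show ?thesis using x by auto
  next
    case True
    then obtain y where y: "y \<in> L" "y \<notin> U0" by blast
    have U0: "subspace U0" using insert.prems by simp
    let ?bad = "\<lambda>U. {c. y + scale c x \<in> U}"
    have fin1: "finite (?bad U)" if U: "U \<in> \<U>" "\<not> L \<subseteq> U" for U
    proof (rule ccontr)
      have sU: "subspace U" using insert.prems U by simp
      assume "infinite (?bad U)"
      then obtain c where c: "c \<in> ?bad U" using infinite_imp_nonempty by blast
      have "infinite (?bad U - {c})" using \<open>infinite (?bad U)\<close> by simp
      then obtain d where d: "d \<in> ?bad U - {c}" using infinite_imp_nonempty by blast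
      have "(y + scale c x) - (y + scale d x) \<in> U" by (rule subspace_diff[OF sU]) (use c d in auto)
      then have "scale (c - d) x \<in> U" by (simp add: scale_left_diff_distrib)
      then have "scale (inverse (c - d)) (scale (c - d) x) \<in> U" using sU subspace_scale by blast
      moreover have "inverse (c - d) * (c - d) = 1" using d by (intro left_inverse) auto
      ultimately have "x \<in> U" by simp
      then show False using x(2) U by blast
    qed
    have "finite (\<Union>U\<in>{U\<in>\<U>. \<not> L \<subseteq> U}. ?bad U)"
      using fin1 insert.hyps by auto
    then obtain c where c: "c \<notin> (\<Union>U\<in>{U\<in>\<U>. \<not> L \<subseteq> U}. ?bad U)"
      using inf ex_new_if_finite by blast
    have "y + scale c x \<notin> U0"
    proof
      assume "y + scale c x \<in> U0"
      moreover have "scale c x \<in> U0" using True U0 by (simp add: subspace_scale)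
      ultimately have "(y + scale c x) - scale c x \<in> U0" by (rule subspace_diff[OF U0])
      then show False using y(2) by simp
    qed
    moreover have "y + scale c x \<in> L" using x(1) y(1) L by (simp add: subspace_add subspace_scale)
    ultimately show ?thesis using c by blast
  qed
qed

lemma vector_space_field: "vector_space ((*) :: 'a \<Rightarrow> 'a \<Rightarrow> 'a)"
  by standard (simp_all add: algebra_simps)

lemma exists_functional_separating:
  assumes "subspace U" "x \<notin> U"
  shows "\<exists>f. Vector_Spaces.linear scale (*) f \<and> f x = 1 \<and> (\<forall>u\<in>U. f u = 0)"
proof -
  interpret K: vector_space "(*) :: 'a \<Rightarrow> 'a \<Rightarrow> 'a" by (rule vector_space_field)
  interpret vector_space_pair scale "(*) :: 'a \<Rightarrow> 'a \<Rightarrow> 'a" ..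
  obtain C where C: "C \<subseteq> U" "independent C" "U \<subseteq> span C"
    using maximal_independent_subset by blast
  have "span C \<subseteq> U" using C assms(1) span_minimal by blast
  then have xC: "x \<notin> span C" using assms(2) by blast
  then have "independent (insert x C)" "x \<notin> C"
    using independent_insertI[OF xC C(2)] span_base by auto
  then obtain f where f: "Vector_Spaces.linear scale (*) f"
    "\<And>v. v \<in> insert x C \<Longrightarrow> f v = (if v = x then 1 else 0)"
    using linear_independent_extend[of "insert x C" "\<lambda>v. if v = x then 1 else 0"] by blast
  interpret f: Vector_Spaces.linear scale "(*)" f by (rule f)
  have "f u = 0" if "u \<in> U" for u
  proof (rule f.eq_0_on_span)
    show "u \<in> span C" using that C(3) by blast
    show "f c = 0" if "c \<in> C" for c using f(2)[of c] that \<open>x \<notin> C\<close> by auto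
  qed
  then show ?thesis using f by auto
qed

lemma exists_projection_along:
  assumes "subspace P"
  shows "\<exists>q. Vector_Spaces.linear scale scale q \<and> (\<forall>p\<in>P. q p = 0) \<and> (\<forall>v. q v - v \<in> P)"
proof -
  interpret vector_space_pair scale scale ..
  obtain C where C: "C \<subseteq> P" "independent C" "P \<subseteq> span C"
    using maximal_independent_subset by blast
  obtain D where D: "C \<subseteq> D" "independent D" "UNIV \<subseteq> span D"
    using maximal_independent_subset_extend[of C UNIV] C(2) by auto
  obtain q where q: "Vector_Spaces.linear scale scale q"
    "\<And>v. v \<in> D \<Longrightarrow> q v = (if v \<in> C then 0 else v)"
    using linear_independent_extend[OF D(2), of "\<lambda>v. if v \<in> C then 0 else v"] by blast
  interpret q: Vector_Spaces.linear scale scale q by (rule q)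
  have "q p = 0" if "p \<in> P" for p
  proof (rule q.eq_0_on_span)
    show "p \<in> span C" using that C(3) by blast
    show "q c = 0" if "c \<in> C" for c using q(2)[of c] that D(1) by auto
  qed
  moreover have "q v - v \<in> P" for v
  proof -
    have "v \<in> span D" using D(3) by blast
    then show ?thesis
    proof (induction rule: span_induct_alt)
      case base
      then show ?case by (simp add: subspace_0 assms)
    next
      case (step c x y)
      have "q x - x \<in> P"
        using q(2)[OF step(1)] C(1) assms by (auto simp: subspace_0 subspace_neg)
      then have "scale c (q x - x) + (q y - y) \<in> P"
        using step assms by (simp add: subspace_add subspace_scale)
      then show ?case by (simp add: q.add q.scale scale_right_diff_distrib algebra_simps)
    qed
  qed
  ultimately show ?thesis using q(1) by blast
qed

end

section \<open>Graded pieces of products of linear ideals\<close>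
locale commutative_algebra = vector_space scale
  for scale :: "'k::field \<Rightarrow> 'a::comm_ring_1 \<Rightarrow> 'a" +
  assumes scale_mult: "scale c (x * y) = scale c x * y"
begin

lemma scale_mult_right: "scale c (x * y) = x * scale c y"
  by (metis mult.commute scale_mult)

definition mult_span :: "'a set \<Rightarrow> 'a set \<Rightarrow> 'a set" where
  "mult_span L M = span {l * g | l g. l \<in> L \<and> g \<in> M}"

text \<open>
  When \<open>X\<close> is the space of linear forms of a polynomial ring, this is its homogeneous part of degree
  \<open>d\<close>, and the set defined next is the part of degree \<open>d\<close> of the product of the ideals generated by the
  spaces \<open>L i\<close> of forms.  The recursion uses only products by linear forms, so it makes sense for formal
  polynomials and for polynomial functions alike and is compatible with homomorphisms between them.
\<close>
primrec power_part :: "'a set \<Rightarrow> nat \<Rightarrow> 'a set" where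
  "power_part X 0 = span {1}"
| "power_part X (Suc d) = mult_span X (power_part X d)"

primrec product_part :: "'a set \<Rightarrow> ('i \<Rightarrow> 'a set) \<Rightarrow> 'i list \<Rightarrow> nat \<Rightarrow> 'a set" where
  "product_part X L [] = power_part X"
| "product_part X L (i # is) =
     (\<lambda>d. case d of 0 \<Rightarrow> {0} | Suc e \<Rightarrow> mult_span (L i) (product_part X L is e))"

lemma subspace_mult_span [simp]: "subspace (mult_span L M)"
  by (simp add: mult_span_def)

lemma mult_in_mult_span: "l \<in> L \<Longrightarrow> g \<in> M \<Longrightarrow> l * g \<in> mult_span L M"
  unfolding mult_span_def by (rule span_base) blast

lemma mult_span_subset:
  assumes "subspace T" "\<And>l g. l \<in> L \<Longrightarrow> g \<in> M \<Longrightarrow> l * g \<in> T"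
  shows "mult_span L M \<subseteq> T"
  unfolding mult_span_def by (rule span_minimal) (use assms in auto)

lemma mult_span_mono: "L \<subseteq> L' \<Longrightarrow> M \<subseteq> M' \<Longrightarrow> mult_span L M \<subseteq> mult_span L' M'"
  by (rule mult_span_subset) (auto intro: mult_in_mult_span)

lemma mult_span_span: "mult_span (span A) (span C) = span {a * c | a c. a \<in> A \<and> c \<in> C}"
proof
  let ?T = "span {a * c | a c. a \<in> A \<and> c \<in> C}"
  have 1: "a * g \<in> ?T" if "a \<in> A" "g \<in> span C" for a g
    using that(2)
  proof (induction rule: span_induct_alt)
    case base then show ?case by (simp add: span_zero)
  next
    case (step c x y)
    have "a * x \<in> ?T" by (rule span_base) (use that step in blast)
    then show ?case using step
      by (simp add: distrib_left scale_mult_right[symmetric] span_add span_scale)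
  qed
  have 2: "l * g \<in> ?T" if "l \<in> span A" "g \<in> span C" for l g
    using that(1)
  proof (induction rule: span_induct_alt)
    case base then show ?case by (simp add: span_zero)
  next
    case (step c x y)
    then show ?case using 1[OF step(1) that(2)]
      by (simp add: distrib_right scale_mult[symmetric] span_add span_scale)
  qed
  show "mult_span (span A) (span C) \<subseteq> ?T"
    by (rule mult_span_subset) (use 2 in auto)
  show "?T \<subseteq> mult_span (span A) (span C)"
    unfolding mult_span_def by (rule span_mono) (use span_base in blast)
qed

lemma subspace_power_part [simp]: "subspace (power_part X d)"
  by (cases d) simp_all

lemma subspace_product_part [simp]: "subspace (product_part X L is d)"
  by (cases "is") (auto split: nat.split)

text \<open>
  The pieces are those of an ideal: a factor from \<open>X\<close> moves past the factors from the \<open>L i\<close> to the innermost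
  place.
\<close>
lemma mult_in_product_part:
  assumes "l \<in> X" "g \<in> product_part X L is d"
  shows "l * g \<in> product_part X L is (Suc d)"
  using assms(2)
proof (induction "is" arbitrary: d g)
  case Nil
  then show ?case using assms(1) by (simp add: mult_in_mult_span)
next
  case (Cons i "is")
  show ?case
  proof (cases d)
    case 0
    then show ?thesis using Cons.prems by (simp add: subspace_0)
  next
    case (Suc e)
    have "mult_span (L i) (product_part X L is e)
        \<subseteq> {g. l * g \<in> mult_span (L i) (product_part X L is d)}"
    proof (rule mult_span_subset)
      show "subspace {g. l * g \<in> mult_span (L i) (product_part X L is d)}"
        by (rule subspaceI)
          (auto simp: subspace_0 distrib_left subspace_add scale_mult_right[symmetric] subspace_scale)
      fix a h assume "a \<in> L i" "h \<in> product_part X L is e"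
      then have "a * (l * h) \<in> mult_span (L i) (product_part X L is d)"
        using Cons.IH Suc by (simp add: mult_in_mult_span)
      then show "a * h \<in> {g. l * g \<in> mult_span (L i) (product_part X L is d)}"
        by (simp add: mult.left_commute)
    qed
    then show ?thesis using Cons.prems Suc by auto
  qed
qed

lemma product_part_subset_power_part:
  assumes "\<And>i. i \<in> set is \<Longrightarrow> L i \<subseteq> X"
  shows "product_part X L is d \<subseteq> power_part X d"
  using assms
proof (induction "is" arbitrary: d)
  case Nil then show ?case by simp
next
  case (Cons i "is")
  show ?case
  proof (cases d)
    case 0
    then show ?thesis by (simp add: span_zero)
  next
    case (Suc e)
    have "mult_span (L i) (product_part X L is e) \<subseteq> mult_span X (power_part X e)"
      using Cons by (intro mult_span_mono) auto
    then show ?thesis using Suc by simp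
  qed
qed

lemma power_part_finite_span:
  assumes "X \<subseteq> span F" "finite F"
  shows "\<exists>G. finite G \<and> power_part X d \<subseteq> span G"
proof (induction d)
  case 0 show ?case by (auto intro!: exI[of _ "{1}"])
next
  case (Suc d)
  then obtain G where G: "finite G" "power_part X d \<subseteq> span G" by blast
  have "power_part X (Suc d) \<subseteq> mult_span (span F) (span G)"
    using G assms by (simp add: mult_span_mono)
  moreover have "finite {a * c | a c. a \<in> F \<and> c \<in> G}"
    using G(1) assms(2) by (simp add: finite_image_set2)
  ultimately show ?case unfolding mult_span_span by blast
qed

end


section \<open>Polynomial functions over an infinite field\<close>
definition fscale :: "'k::field \<Rightarrow> ('x \<Rightarrow> 'k) \<Rightarrow> 'x \<Rightarrow> 'k" where
  "fscale c f = (\<lambda>v. c * f v)"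

lemmas fun_apply = plus_fun_apply zero_fun_apply times_fun_apply one_fun_apply minus_apply
  fscale_def

text \<open>
  Pointwise evaluation has to be requested explicitly.  As simplification rules these equations also
  rewrite the eta-expanded arguments of linear functionals on function spaces.
\<close>
declare plus_fun_apply [simp del] zero_fun_apply [simp del] times_fun_apply [simp del]
  one_fun_apply [simp del] minus_apply [simp del]

lemma sum_fun_apply: "sum f A v = (\<Sum>a\<in>A. f a v)" for f :: "'i \<Rightarrow> 'x \<Rightarrow> 'k::field"
  by (induction A rule: infinite_finite_induct) (simp_all add: fun_apply)

text \<open>
  Points of the affine space are functions too, but they are combined only by this operation, so that
  the pointwise rules for polynomial functions leave them alone.
\<close>
definition line :: "('b \<Rightarrow> 'k::field) \<Rightarrow> 'k \<Rightarrow> ('b \<Rightarrow> 'k) \<Rightarrow> 'b \<Rightarrow> 'k" where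
  "line v c w = (\<lambda>b. v b + c * w b)"

definition origin :: "'b \<Rightarrow> 'k::field" where
  "origin = (\<lambda>b. 0)"

lemma line_trivial [simp]: "line v 0 w = v" "line v c origin = v"
  by (simp_all add: line_def origin_def)

lemma commutative_algebra_fscale:
  "commutative_algebra (fscale :: 'k::field \<Rightarrow> ('x \<Rightarrow> 'k) \<Rightarrow> 'x \<Rightarrow> 'k)"
  by standard (simp_all add: fun_eq_iff fun_apply algebra_simps)

lemma poly_eqI_infinite:
  fixes p q :: "'k::field poly"
  assumes "infinite (UNIV :: 'k set)" "\<And>t. poly p t = poly q t"
  shows "p = q"
proof (rule ccontr)
  assume "p \<noteq> q"
  then have "finite {t. poly (p - q) t = 0}" by (intro poly_roots_finite) simp
  then show False using assms by simp
qed

lemma poly_poly_const: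
  "poly (poly q [:t:]) s = poly (map_poly (\<lambda>c. poly c s) q) t"
  by (induction q) (simp_all add: map_poly_pCons)

text \<open>
  A linear polynomial with nonzero constant term is a unit modulo every power of the variable.
\<close>
lemma monom_1_dvd_cancel_unit:
  fixes q :: "'k::field poly"
  assumes "monom 1 k dvd [:a, b:] * q" "a \<noteq> 0"
  shows "monom 1 k dvd q"
proof -
  have prod: "coeff ([:a, b:] * q) i = 0" if "i < k" for i
    using assms(1) that unfolding monom_1_dvd_iff' by blast
  have "coeff q i = 0" if "i < k" for i
    using that
  proof (induction i)
    case 0
    then show ?case using prod[of 0] assms(2) by simp
  next
    case (Suc i)
    then show ?case using prod[of "Suc i"] assms(2) by simp
  qed
  then show ?thesis by (simp add: monom_1_dvd_iff')
qed

text \<open>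
  The points are all families indexed by \<open>'b\<close>, but only the coordinates in \<open>B\<close> are used as functions.  The set
  \<open>E\<close> of coordinate functions is a parameter because the field has to occur in the type of some parameter.
\<close>
locale polynomial_functions =
  fixes B :: "'b set" and E :: "(('b \<Rightarrow> 'k::field) \<Rightarrow> 'k) set"
  assumes finite_B: "finite B"
    and infinite_field: "infinite (UNIV :: 'k set)"
    and E_eq: "E = (\<lambda>b v. v b) ` B"
begin

sublocale commutative_algebra "fscale :: 'k \<Rightarrow> (('b \<Rightarrow> 'k) \<Rightarrow> 'k) \<Rightarrow> ('b \<Rightarrow> 'k) \<Rightarrow> 'k"
  by (rule commutative_algebra_fscale)

definition forms :: "(('b \<Rightarrow> 'k) \<Rightarrow> 'k) set" where
  "forms = span E"

abbreviation homogeneous :: "nat \<Rightarrow> (('b \<Rightarrow> 'k) \<Rightarrow> 'k) set" where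
  "homogeneous \<equiv> power_part forms"

definition zeros :: "(('b \<Rightarrow> 'k) \<Rightarrow> 'k) set \<Rightarrow> ('b \<Rightarrow> 'k) set" where
  "zeros U = {v. \<forall>u\<in>U. u v = 0}"

lemma subspace_forms [simp]: "subspace forms"
  by (simp add: forms_def)

lemma form_add_scale:
  assumes "u \<in> forms"
  shows "u (line v c w) = u v + c * u w"
  using assms unfolding forms_def
proof (induction rule: span_induct_alt)
  case base then show ?case by (simp add: fun_apply)
next
  case (step a x y)
  then show ?case by (auto simp: E_eq fun_apply line_def algebra_simps)
qed

lemma form_origin: "u \<in> forms \<Longrightarrow> u origin = 0"
  using form_add_scale[of u origin "-1" origin] by simp

lemma zeros_add_scale:
  assumes "U \<subseteq> forms" "v \<in> zeros U" "w \<in> zeros U"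
  shows "line v c w \<in> zeros U"
proof -
  have "u (line v c w) = 0" if "u \<in> U" for u
    
  proof -
    have "u \<in> forms" "u v = 0" "u w = 0" using assms that by (auto simp: zeros_def)
    then show ?thesis by (simp add: form_add_scale)
  qed
  then show ?thesis by (simp add: zeros_def)
qed

lemma origin_in_zeros: "U \<subseteq> forms \<Longrightarrow> origin \<in> zeros U"
  using form_origin unfolding zeros_def by auto

lemma zeros_antimono: "U \<subseteq> W \<Longrightarrow> zeros W \<subseteq> zeros U"
  unfolding zeros_def by auto

lemma zeros_span [simp]: "zeros (span U) = zeros U"
proof
  show "zeros U \<subseteq> zeros (span U)"
  proof
    fix v assume v: "v \<in> zeros U"
    have "u v = 0" if "u \<in> span U" for u
      using that by (induction rule: span_induct_alt) (use v in \<open>auto simp: zeros_def fun_apply\<close>)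
    then show "v \<in> zeros (span U)" by (simp add: zeros_def)
  qed
qed (simp add: zeros_antimono span_superset)

text \<open>
  A functional \<open>f\<close> on the space of functions with \<open>f x = 1\<close> that
  kills \<open>U\<close> is, on linear forms, evaluation at the point whose coordinate \<open>b\<close> is the value of \<open>f\<close> at the
  \<open>b\<close>-th coordinate function.
\<close>
lemma exists_zero_off_form:
  assumes "x \<in> forms" "subspace U" "x \<notin> U"
  shows "\<exists>y\<in>zeros (U \<inter> forms). x y \<noteq> 0"
proof -
  obtain f where f: "Vector_Spaces.linear fscale (*) f" "f x = 1" "\<forall>u\<in>U. f u = 0"
    using exists_functional_separating[OF assms(2,3)] by blast
  interpret f: Vector_Spaces.linear fscale "(*)" f by (rule f(1))
  define y where "y = (\<lambda>b. f (\<lambda>v. v b))"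
  have eval: "u y = f u" if "u \<in> forms" for u
    using that unfolding forms_def
  proof (induction rule: span_induct_alt)
    case base show ?case by (simp add: f.zero zero_fun_apply[of y])
  next
    case (step c x z)
      then have "x y = f x" by (auto simp: E_eq y_def)
    moreover have "(fscale c x + z) y = c * x y + z y" by (simp add: fun_apply)
    ultimately show ?case using step.IH by (simp add: f.add f.scale)
  qed
  have "y \<in> zeros (U \<inter> forms)" using f(3) eval by (auto simp: zeros_def)
  moreover have "x y \<noteq> 0" using eval[OF assms(1)] f(2) by simp
  ultimately show ?thesis by blast
qed

section \<open>Order of vanishing along a linear subspace\<close>
text \<open>
  On a line through \<open>y\<close> in direction \<open>z\<close>, both moving linearly with \<open>s\<close>, a polynomial function is a polynomial
  in \<open>t\<close> whose coefficients are polynomials in \<open>s\<close>.  This allows conclusions that hold for almost all \<open>s\<close> to be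
  extended to \<open>s = 0\<close>.
\<close>
lemma homogeneous_on_plane:
  assumes "f \<in> homogeneous d"
  shows "\<exists>q :: 'k poly poly. \<forall>s t. f (line (line y s y') t (line z s z')) = poly (poly q [:t:]) s"
  using assms
proof (induction d arbitrary: f)
  case 0
  then obtain c where "f = fscale c 1" 
    by (metis power_part.simps(1) span_singleton rangeE)
  then show ?case by (intro exI[of _ "[:[:c:]:]"]) (simp add: fun_apply)
next
  case (Suc d)
  from Suc.prems show ?case
    unfolding power_part.simps mult_span_def
  proof (induction rule: span_induct_alt)
    case base
    then show ?case by (auto simp: fun_apply intro!: exI[of _ 0])
  next
    case (step c x f)
    then obtain u g where ug: "u \<in> forms" "g \<in> homogeneous d" "x = u * g" by blast
    obtain q where q: "\<And>s t. g (line (line y s y') t (line z s z')) = poly (poly q [:t:]) s"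
      using Suc.IH[OF ug(2)] by blast
    obtain r where r: "\<And>s t. f (line (line y s y') t (line z s z')) = poly (poly r [:t:]) s"
      using step.IH by blast
    have u: "u (line (line y s y') t (line z s z'))
        = poly (poly [:[:u y, u y':], [:u z, u z':]:] [:t:]) s" for s t
      by (simp add: form_add_scale[OF ug(1)] algebra_simps)
    have "(fscale c x + f) (line (line y s y') t (line z s z'))
        = poly (poly ([:[:c:]:] * ([:[:u y, u y':], [:u z, u z':]:] * q) + r) [:t:]) s" for s t
      unfolding fun_apply ug(3) q r u by (simp add: algebra_simps)
    then show ?case by blast
  qed
qed

lemma homogeneous_on_line:
  assumes "f \<in> homogeneous d"
  shows "\<exists>q :: 'k poly. \<forall>t. f (line y t z) = poly q t"
proof -
  obtain q :: "'k poly poly"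
    where q: "\<And>s t. f (line (line y s origin) t (line z s origin)) = poly (poly q [:t:]) s"
    using homogeneous_on_plane[OF assms, of y origin z origin] by blast
  then show ?thesis using q[of 0] by (auto simp: poly_poly_const)
qed

text \<open>
  For \<open>P \<subseteq> U\<close> this says that the restriction of \<open>f\<close> to the linear space \<open>zeros P\<close> vanishes to order \<open>k\<close> along its
  subspace \<open>zeros U\<close>, equivalently that \<open>f \<in> (U)\<^sup>k + (P)\<close>.
\<close>
definition vanishes_to_order ::
    "nat \<Rightarrow> (('b \<Rightarrow> 'k) \<Rightarrow> 'k) set \<Rightarrow> (('b \<Rightarrow> 'k) \<Rightarrow> 'k) set \<Rightarrow> (('b \<Rightarrow> 'k) \<Rightarrow> 'k) \<Rightarrow> bool" where
  "vanishes_to_order k U P f \<longleftrightarrow>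
     (\<forall>y\<in>zeros U. \<forall>z\<in>zeros P. \<exists>p. \<forall>t. f (line y t z) = t ^ k * poly p t)"

lemma vanishes_to_order_mono:
  assumes "vanishes_to_order k U P f" "zeros U' \<subseteq> zeros U" "zeros P' \<subseteq> zeros P"
  shows "vanishes_to_order k U' P' f"
  using assms unfolding vanishes_to_order_def by blast

lemma subspace_vanishes_to_order: "subspace {f. vanishes_to_order k U P f}"
proof (rule subspaceI)
  show "0 \<in> {f. vanishes_to_order k U P f}"
    by (auto simp: vanishes_to_order_def fun_apply intro!: exI[of _ 0])
  show "f + g \<in> {f. vanishes_to_order k U P f}"
    if fg: "f \<in> {f. vanishes_to_order k U P f}" "g \<in> {f. vanishes_to_order k U P f}" for f g
    unfolding mem_Collect_eq vanishes_to_order_def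
  proof (intro ballI)
    fix y z assume yz: "y \<in> zeros U" "z \<in> zeros P"
    obtain p q where "\<And>t. f (line y t z) = t ^ k * poly p t" "\<And>t. g (line y t z) = t ^ k * poly q t"
      using fg yz unfolding vanishes_to_order_def by blast
    then show "\<exists>p. \<forall>t. (f + g) (line y t z) = t ^ k * poly p t"
      by (intro exI[of _ "p + q"]) (simp add: fun_apply algebra_simps)
  qed
  show "fscale c f \<in> {f. vanishes_to_order k U P f}"
    if f: "f \<in> {f. vanishes_to_order k U P f}" for c f
    unfolding mem_Collect_eq vanishes_to_order_def
  proof (intro ballI)
    fix y z assume yz: "y \<in> zeros U" "z \<in> zeros P"
    obtain p where "\<And>t. f (line y t z) = t ^ k * poly p t"
      using f yz unfolding vanishes_to_order_def by blast
    then show "\<exists>p. \<forall>t. fscale c f (line y t z) = t ^ k * poly p t"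
      by (intro exI[of _ "smult c p"]) (simp add: fun_apply algebra_simps)
  qed
qed

text \<open>
  The value of \<open>x\<close> has order exactly \<open>e\<close> in \<open>t\<close> for all \<open>s\<close> except \<open>- a / b\<close>.  For these \<open>s\<close> the order of \<open>g\<close> is at
  least \<open>k\<close>, that is, its first \<open>k\<close> coefficients vanish.  The coefficients are polynomials in \<open>s\<close> with
  infinitely many roots, so they vanish identically, in particular at \<open>s = 0\<close>.
\<close>
lemma vanishes_on_plane_cancel:
  assumes g: "g \<in> homogeneous d" and "b \<noteq> 0"
    and x: "\<And>s t. x (line (line y s y') t (line z s z')) = t ^ e * (a + b * s + c * t)"
    and xg: "\<And>s. \<exists>p. \<forall>t. (x * g) (line (line y s y') t (line z s z')) = t ^ (k + e) * poly p t"
  shows "\<exists>p. \<forall>t. g (line y t z) = t ^ k * poly p t"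
proof -
  obtain q :: "'k poly poly"
    where q: "\<And>s t. g (line (line y s y') t (line z s z')) = poly (poly q [:t:]) s"
    using homogeneous_on_plane[OF g, of y y' z z'] by blast
  have zero: "poly (coeff q i) s = 0" if i: "i < k" and s: "a + b * s \<noteq> 0" for i s
  proof -
    let ?q = "map_poly (\<lambda>c. poly c s) q"
    obtain p where p: "\<And>t. (x * g) (line (line y s y') t (line z s z')) = t ^ (k + e) * poly p t"
      using xg by blast
    have "monom 1 e * ([:a + b * s, c:] * ?q) = monom 1 e * (monom 1 k * p)"
    proof (rule poly_eqI_infinite[OF infinite_field])
      show "poly (monom 1 e * ([:a + b * s, c:] * ?q)) t = poly (monom 1 e * (monom 1 k * p)) t" for t
        using p[of t, unfolded times_fun_apply x q poly_poly_const]
        by (simp add: poly_monom power_add algebra_simps)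
    qed
    then have "[:a + b * s, c:] * ?q = monom 1 k * p" by (simp add: monom_eq_0_iff)
    then have "monom 1 k dvd ?q"
      using monom_1_dvd_cancel_unit[of k "a + b * s" c ?q] s by simp
    then have "coeff ?q i = 0" using i by (simp add: monom_1_dvd_iff')
    then show ?thesis by (simp add: coeff_map_poly)
  qed
  have "coeff q i = 0" if i: "i < k" for i
  proof (rule ccontr)
    assume "coeff q i \<noteq> 0"
    then have "finite {s. poly (coeff q i) s = 0}" by (rule poly_roots_finite)
    moreover have "UNIV \<subseteq> {s. poly (coeff q i) s = 0} \<union> {- a / b}"
    proof
      fix s
      show "s \<in> {s. poly (coeff q i) s = 0} \<union> {- a / b}"
        using zero[OF i, of s] \<open>b \<noteq> 0\<close> by (cases "a + b * s = 0") (auto simp: field_simps eq_neg_iff_add_eq_0)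
    qed
    ultimately show False using infinite_field by (meson finite.emptyI finite.insertI finite_UnI finite_subset)
  qed
  then have "monom 1 k dvd map_poly (\<lambda>c. poly c 0) q"
    by (simp add: monom_1_dvd_iff' coeff_map_poly)
  then obtain p where p: "map_poly (\<lambda>c. poly c 0) q = monom 1 k * p" by (rule dvdE)
  have "g (line y t z) = t ^ k * poly p t" for t
  proof -
    have "g (line y t z) = poly (map_poly (\<lambda>c. poly c 0) q) t"
      using q[of 0 t] by (simp add: poly_poly_const)
    then show ?thesis by (simp add: p poly_monom)
  qed
  then show ?thesis by blast
qed

text \<open>
  A form \<open>x\<close> that does not vanish on \<open>zeros U\<close> is invertible at a general point of it.  The points of \<open>zeros U\<close>
  with \<open>x = 0\<close> are approached within \<open>zeros U\<close>, along a direction \<open>y'\<close> with \<open>x y' \<noteq> 0\<close>.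
\<close>
lemma vanishes_to_order_cancel_nonvanishing:
  assumes U: "U \<subseteq> forms" and x: "x \<in> forms" "x \<notin> span U" and g: "g \<in> homogeneous d"
    and xg: "vanishes_to_order k U P (x * g)"
  shows "vanishes_to_order k U P g"
  unfolding vanishes_to_order_def
proof (intro ballI)
  fix y z assume yz: "y \<in> zeros U" "z \<in> zeros P"
  have "span U \<subseteq> forms" using U by (simp add: span_minimal)
  then obtain y' where y': "y' \<in> zeros U" "x y' \<noteq> 0"
    using exists_zero_off_form[OF x(1) subspace_span x(2)] by (auto simp: Int_absorb2)
  show "\<exists>p. \<forall>t. g (line y t z) = t ^ k * poly p t"
  proof (rule vanishes_on_plane_cancel[OF g y'(2), where y=y and y'=y' and z=z and z'=origin and e=0 and a="x y" and c="x z" and x=x])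
    show "x (line (line y s y') t (line z s origin)) = t ^ 0 * (x y + x y' * s + x z * t)" for s t
      unfolding form_add_scale[OF x(1)] by (simp add: form_origin[OF x(1)] algebra_simps)
    have "line y s y' \<in> zeros U" for s by (rule zeros_add_scale[OF U yz(1) y'(1)])
    then show "\<exists>p. \<forall>t. (x * g) (line (line y s y') t (line z s origin)) = t ^ (k + 0) * poly p t" for s
      using xg yz(2) by (simp add: vanishes_to_order_def)
  qed
qed

text \<open>
  A form \<open>x\<close> that vanishes on \<open>zeros U\<close> but not on \<open>zeros P\<close> vanishes to order exactly one in a general
  direction of \<open>zeros P\<close>, so cancelling it costs exactly one order.  Here the directions are moved instead
  of the base points.
\<close>
lemma vanishes_to_order_cancel_transversal:
  assumes P: "P \<subseteq> forms" and x: "x \<in> forms" "x \<in> span U" "x \<notin> span P" and g: "g \<in> homogeneous d"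
    and xg: "vanishes_to_order (Suc k) U P (x * g)"
  shows "vanishes_to_order k U P g"
  unfolding vanishes_to_order_def
proof (intro ballI)
  fix y z assume yz: "y \<in> zeros U" "z \<in> zeros P"
  have "span P \<subseteq> forms" using P by (simp add: span_minimal)
  then obtain z' where z': "z' \<in> zeros P" "x z' \<noteq> 0"
    using exists_zero_off_form[OF x(1) subspace_span x(3)] by (auto simp: Int_absorb2)
  have xy: "x y = 0" using yz(1) x(2) zeros_span[of U] unfolding zeros_def by blast
  show "\<exists>p. \<forall>t. g (line y t z) = t ^ k * poly p t"
  proof (rule vanishes_on_plane_cancel[OF g z'(2), where y=y and y'=origin and z=z and z'=z' and e=1 and a="x z" and c=0 and x=x])
    show "x (line (line y s origin) t (line z s z')) = t ^ 1 * (x z + x z' * s + 0 * t)" for s t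
      unfolding form_add_scale[OF x(1)] by (simp add: form_origin[OF x(1)] xy algebra_simps)
    have "line z s z' \<in> zeros P" for s by (rule zeros_add_scale[OF P yz(2) z'(1)])
    then show "\<exists>p. \<forall>t. (x * g) (line (line y s origin) t (line z s z')) = t ^ (k + 1) * poly p t" for s
      using xg yz(1) by (simp add: vanishes_to_order_def)
  qed
qed

text \<open>
  The ideal \<open>(P)\<close> is treated as a product with a single factor, so that it inherits the lemmas on products.
\<close>
definition ideal_part :: "(('b \<Rightarrow> 'k) \<Rightarrow> 'k) set \<Rightarrow> nat \<Rightarrow> (('b \<Rightarrow> 'k) \<Rightarrow> 'k) set" where
  "ideal_part P = product_part forms (\<lambda>_::unit. P) [()]"

lemma ideal_part_0 [simp]: "ideal_part P 0 = {0}"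
  and ideal_part_Suc [simp]: "ideal_part P (Suc d) = mult_span P (homogeneous d)"
  by (simp_all add: ideal_part_def)

lemma subspace_ideal_part [simp]: "subspace (ideal_part P d)"
  unfolding ideal_part_def by (rule subspace_product_part)

lemma ideal_part_subset: "P \<subseteq> forms \<Longrightarrow> ideal_part P d \<subseteq> homogeneous d"
  unfolding ideal_part_def by (rule product_part_subset_power_part)

lemma mult_in_ideal_part: "u \<in> forms \<Longrightarrow> g \<in> ideal_part P d \<Longrightarrow> u * g \<in> ideal_part P (Suc d)"
  unfolding ideal_part_def by (rule mult_in_product_part)

text \<open>
  The linear case of the Nullstellensatz.  A projection of the space of forms along \<open>P\<close> is dual to a linear
  retraction \<open>\<pi>\<close> of the points onto \<open>zeros P\<close>.  A form \<open>u\<close> differs from \<open>u \<circ> \<pi>\<close> by an element of \<open>P\<close>, hence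
  \<open>f - f \<circ> \<pi> \<in> (P)\<close> for every polynomial \<open>f\<close>, and \<open>f \<circ> \<pi> = 0\<close> if \<open>f\<close> vanishes on \<open>zeros P\<close>.
\<close>
lemma in_ideal_part_if_vanishing:
  assumes P: "subspace P" "P \<subseteq> forms" and f: "f \<in> homogeneous d" and f0: "\<And>v. v \<in> zeros P \<Longrightarrow> f v = 0"
  shows "f \<in> ideal_part P d"
proof -
  obtain q where q: "Vector_Spaces.linear fscale fscale q" "\<forall>p\<in>P. q p = 0" "\<forall>v. q v - v \<in> P"
    using exists_projection_along[OF P(1)] by blast
  interpret q: Vector_Spaces.linear fscale fscale q by (rule q(1))
  define \<pi> where "\<pi> = (\<lambda>v b. q (\<lambda>w. w b) v)"
  have q_forms: "q u \<in> forms" if "u \<in> forms" for u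
    using that q(3) P(2) subspace_add[OF subspace_forms, of "q u - u" u] by auto
  have comp: "u \<circ> \<pi> = q u" if "u \<in> forms" for u
    using that unfolding forms_def
  proof (induction rule: span_induct_alt)
    case base show ?case unfolding q.zero by (simp add: fun_eq_iff fun_apply)
  next
    case (step c x z)
    have "(fscale c x + z) \<circ> \<pi> = fscale c (x \<circ> \<pi>) + (z \<circ> \<pi>)" by (simp add: fun_eq_iff fun_apply)
    moreover have "x \<circ> \<pi> = q x" using step(1) by (auto simp: E_eq \<pi>_def fun_eq_iff)
    ultimately show ?case by (simp add: step.IH q.add q.scale)
  qed
  have "f - (f \<circ> \<pi>) \<in> ideal_part P d"
    using f
  proof (induction d arbitrary: f)
    case 0
    then obtain c where "f = fscale c 1"
      by (metis power_part.simps(1) span_singleton rangeE)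
    then show ?case by (simp add: fun_eq_iff fun_apply)
  next
    case (Suc d)
    from Suc.prems show ?case
      unfolding power_part.simps mult_span_def
    proof (induction rule: span_induct_alt)
      case base
      have "0 - (0 \<circ> \<pi>) = (0 :: ('b \<Rightarrow> 'k) \<Rightarrow> 'k)" by (simp add: fun_eq_iff fun_apply)
      then show ?case using subspace_0[OF subspace_ideal_part] by metis
    next
      case (step c x f)
      then obtain u g where ug: "u \<in> forms" "g \<in> homogeneous d" "x = u * g" by blast
      have x: "x - (x \<circ> \<pi>) = (u - q u) * g + q u * (g - (g \<circ> \<pi>))"
        unfolding ug(3) comp[OF ug(1), symmetric] by (simp add: fun_eq_iff fun_apply algebra_simps)
      have "u - q u \<in> P" using q(3) subspace_neg[OF P(1), of "q u - u"] by simp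
      then have "(u - q u) * g \<in> ideal_part P (Suc d)" using ug(2) by (simp add: mult_in_mult_span)
      moreover have "q u * (g - (g \<circ> \<pi>)) \<in> ideal_part P (Suc d)"
        by (rule mult_in_ideal_part[OF q_forms[OF ug(1)] Suc.IH[OF ug(2)]])
      ultimately have "x - (x \<circ> \<pi>) \<in> ideal_part P (Suc d)"
        unfolding x by (rule subspace_add[OF subspace_ideal_part])
      then have "fscale c (x - (x \<circ> \<pi>)) + (f - (f \<circ> \<pi>)) \<in> ideal_part P (Suc d)"
        using step.IH by (intro subspace_add[OF subspace_ideal_part] subspace_scale[OF subspace_ideal_part])
      moreover have "fscale c (x - (x \<circ> \<pi>)) + (f - (f \<circ> \<pi>)) = (fscale c x + f) - ((fscale c x + f) \<circ> \<pi>)"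
        by (simp add: fun_eq_iff fun_apply algebra_simps)
      ultimately show ?case by (simp only:)
    qed
  qed
  moreover have "\<pi> v \<in> zeros P" for v
    unfolding zeros_def
  proof (intro CollectI ballI)
    fix p assume p: "p \<in> P"
    then have "p \<circ> \<pi> = q p" using comp P(2) by blast
    then show "p (\<pi> v) = 0" using q(2) p by (metis comp_apply zero_fun_apply)
  qed
  then have "f \<circ> \<pi> = 0" using f0 by (simp add: fun_eq_iff fun_apply)
  ultimately show ?thesis by simp
qed

section \<open>Primary decomposition of a product of linear ideals\<close>
definition arrangement :: "('i \<Rightarrow> (('b \<Rightarrow> 'k) \<Rightarrow> 'k) set) \<Rightarrow> 'i set \<Rightarrow> bool" where
  "arrangement L I \<longleftrightarrow> (\<forall>i\<in>I. subspace (L i) \<and> L i \<subseteq> forms)"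

text \<open>
  The part of degree \<open>d\<close> of \<open>J + (P)\<close>, where \<open>J\<close> is the product of the ideals \<open>(L i)\<close>: this stands for the image
  of \<open>J\<close> in the polynomial ring modulo \<open>P\<close>.
\<close>
definition sum_part where
  "sum_part P L is d = span (product_part forms L is d \<union> ideal_part P d)"

abbreviation join where
  "join P L A \<equiv> P \<union> (\<Union>i\<in>A. L i)"

lemma arrangement_Cons [simp]:
  "arrangement L (insert i I) \<longleftrightarrow> subspace (L i) \<and> L i \<subseteq> forms \<and> arrangement L I"
  by (auto simp: arrangement_def)

lemma join_subset_forms: "P \<subseteq> forms \<Longrightarrow> arrangement L I \<Longrightarrow> A \<subseteq> I \<Longrightarrow> join P L A \<subseteq> forms"
  unfolding arrangement_def by blast

lemma subspace_sum_part [simp]: "subspace (sum_part P L is d)"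
  by (simp add: sum_part_def)

lemma in_sum_part_iff:
  "f \<in> sum_part P L is d \<longleftrightarrow> (\<exists>j\<in>product_part forms L is d. \<exists>p\<in>ideal_part P d. f = j + p)"
  unfolding sum_part_def span_Un span_eq_iff[THEN iffD2, OF subspace_product_part]
    span_eq_iff[THEN iffD2, OF subspace_ideal_part] by blast

lemma product_part_subset_sum_part: "product_part forms L is d \<subseteq> sum_part P L is d"
  and ideal_part_subset_sum_part: "ideal_part P d \<subseteq> sum_part P L is d"
  unfolding sum_part_def using span_superset by blast+

lemma sum_part_subset_homogeneous:
  assumes "P \<subseteq> forms" "arrangement L (set is)"
  shows "sum_part P L is d \<subseteq> homogeneous d"
  unfolding sum_part_def using assms
  by (intro span_minimal Un_least ideal_part_subset product_part_subset_power_part)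
    (auto simp: arrangement_def)

lemma mult_in_sum_part:
  assumes "x \<in> L i" "x \<in> forms" "g \<in> sum_part P L is d"
  shows "x * g \<in> sum_part P L (i # is) (Suc d)"
proof -
  obtain j p where jp: "j \<in> product_part forms L is d" "p \<in> ideal_part P d" "g = j + p"
    using assms(3) in_sum_part_iff by blast
  have "x * j \<in> product_part forms L (i # is) (Suc d)"
    using assms(1) jp(1) by (simp add: mult_in_mult_span)
  moreover have "x * p \<in> ideal_part P (Suc d)" by (rule mult_in_ideal_part[OF assms(2) jp(2)])
  ultimately show ?thesis unfolding jp(3) distrib_left in_sum_part_iff by blast
qed

lemma vanishes_to_order_form_mult:
  assumes "l \<in> forms" "vanishes_to_order k U P g"
  shows "vanishes_to_order k U P (l * g)"
  unfolding vanishes_to_order_def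
proof (intro ballI)
  fix y z assume "y \<in> zeros U" "z \<in> zeros P"
  then obtain p where p: "\<And>t. g (line y t z) = t ^ k * poly p t"
    using assms(2) unfolding vanishes_to_order_def by blast
  show "\<exists>p. \<forall>t. (l * g) (line y t z) = t ^ k * poly p t"
    by (rule exI[of _ "[:l y, l z:] * p"])
      (simp add: fun_apply p form_add_scale[OF assms(1)] algebra_simps)
qed

lemma vanishes_to_order_Suc_form_mult:
  assumes "l \<in> forms" "l \<in> U" "vanishes_to_order k U P g"
  shows "vanishes_to_order (Suc k) U P (l * g)"
  unfolding vanishes_to_order_def
proof (intro ballI)
  fix y z assume yz: "y \<in> zeros U" "z \<in> zeros P"
  then obtain p where p: "\<And>t. g (line y t z) = t ^ k * poly p t"
    using assms(3) unfolding vanishes_to_order_def by blast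
  have "l y = 0" using yz(1) assms(2) by (simp add: zeros_def)
  then show "\<exists>p. \<forall>t. (l * g) (line y t z) = t ^ Suc k * poly p t"
    by (intro exI[of _ "smult (l z) p"])
      (simp add: fun_apply p form_add_scale[OF assms(1)] algebra_simps)
qed

text \<open>
  Each factor with index in \<open>A\<close> vanishes on \<open>zeros (join P L A)\<close> and contributes one order.
\<close>
lemma product_part_vanishes:
  assumes "distinct is" "arrangement L (set is)" "A \<subseteq> set is" "f \<in> product_part forms L is d"
  shows "vanishes_to_order (card A) (join P L A) P f"
  using assms
proof (induction "is" arbitrary: A d f)
  case Nil
  then have "f \<in> homogeneous d" "A = {}" by simp_all
  then show ?case using homogeneous_on_line unfolding vanishes_to_order_def by simp
next
  case (Cons i "is")
  let ?V = "{f. vanishes_to_order (card A) (join P L A) P f}"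
  have "mult_span (L i) (product_part forms L is e) \<subseteq> ?V" for e
  proof (rule mult_span_subset[OF subspace_vanishes_to_order])
    fix l g assume l: "l \<in> L i" and g: "g \<in> product_part forms L is e"
    have lf: "l \<in> forms" using l Cons.prems by auto
    have van: "vanishes_to_order (card (A - {i})) (join P L (A - {i})) P g"
      using Cons.prems g by (intro Cons.IH) auto
    have "vanishes_to_order (card (A - {i})) (join P L A) P g"
      by (rule vanishes_to_order_mono[OF van]) (auto intro!: zeros_antimono)
    moreover have "finite A" using Cons.prems(3) finite_subset by blast
    ultimately show "l * g \<in> ?V"
    proof (cases "i \<in> A")
      case True
      assume "vanishes_to_order (card (A - {i})) (join P L A) P g" "finite A"
      then have "vanishes_to_order (Suc (card (A - {i}))) (join P L A) P (l * g)"
        using l True by (intro vanishes_to_order_Suc_form_mult[OF lf]) auto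
      then show ?thesis using True \<open>finite A\<close> by (simp add: card_Suc_Diff1 del: card_Diff_insert)
    next
      case False
      assume "vanishes_to_order (card (A - {i})) (join P L A) P g"
      then show ?thesis using False by (simp add: vanishes_to_order_form_mult[OF lf])
    qed
  qed
  then show ?case using Cons.prems(4) subspace_0[OF subspace_vanishes_to_order]
    by (cases d) auto
qed

lemma ideal_part_vanishes_on:
  assumes "p \<in> ideal_part P d" "v \<in> zeros P"
  shows "p v = 0"
proof (cases d)
  case 0
  then show ?thesis using assms(1) by (simp add: fun_apply)
next
  case (Suc e)
  have "mult_span P (homogeneous e) \<subseteq> {f. f v = 0}"
  proof (rule mult_span_subset)
    show "subspace {f. f v = 0}" by (rule subspaceI) (simp_all add: fun_apply)
    show "l * g \<in> {f. f v = 0}" if "l \<in> P" for l g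
      using assms(2) that by (simp add: zeros_def fun_apply)
  qed
  then show ?thesis using assms(1) Suc by auto
qed

lemma ideal_part_vanishes:
  assumes "P \<subseteq> forms" "P \<subseteq> U" "p \<in> ideal_part P d"
  shows "vanishes_to_order k U P p"
  unfolding vanishes_to_order_def
proof (intro ballI)
  fix y z assume "y \<in> zeros U" "z \<in> zeros P"
  then have "line y t z \<in> zeros P" for t
    using zeros_add_scale[OF assms(1)] zeros_antimono[OF assms(2)] by blast
  then show "\<exists>q. \<forall>t. p (line y t z) = t ^ k * poly q t"
    using ideal_part_vanishes_on[OF assms(3)] by (intro exI[of _ 0]) simp
qed

lemma vanishes_on_if_vanishes_to_order_Suc:
  assumes "P \<subseteq> forms" "zeros P \<subseteq> zeros U" "vanishes_to_order (Suc k) U P f" "v \<in> zeros P"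
  shows "f v = 0"
proof -
  obtain p where "\<And>t. f (line v t origin) = t ^ Suc k * poly p t"
    using assms origin_in_zeros[OF assms(1)] unfolding vanishes_to_order_def by blast
  from this[of 0] show ?thesis by simp
qed

lemma sum_part_vanishes:
  assumes "distinct is" "arrangement L (set is)" "A \<subseteq> set is" "P \<subseteq> forms" "f \<in> sum_part P L is d"
  shows "vanishes_to_order (card A) (join P L A) P f"
proof -
  obtain j p where jp: "j \<in> product_part forms L is d" "p \<in> ideal_part P d" "f = j + p"
    using assms(5) in_sum_part_iff by blast
  then show ?thesis
    using product_part_vanishes[OF assms(1-3) jp(1)]
      ideal_part_vanishes[OF assms(4) Un_upper1 jp(2)]
      subspace_add[OF subspace_vanishes_to_order] by blast
qed

lemma ideal_part_insert:
  "ideal_part (span (insert x P)) (Suc d) = span (ideal_part P (Suc d) \<union> (*) x ` homogeneous d)"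
  if "subspace P"
proof
  let ?S = "span (ideal_part P (Suc d) \<union> (*) x ` homogeneous d)"
  have "mult_span (span (insert x P)) (homogeneous d) \<subseteq> ?S"
  proof (rule mult_span_subset)
    fix l g assume l: "l \<in> span (insert x P)" and g: "g \<in> homogeneous d"
    obtain k where "l - fscale k x \<in> span P" using l unfolding span_insert by blast
    then have "l - fscale k x \<in> P" using that by (simp add: span_eq_iff[THEN iffD2])
    then have "(l - fscale k x) * g \<in> ideal_part P (Suc d)" using g by (simp add: mult_in_mult_span)
    moreover have "x * fscale k g \<in> (*) x ` homogeneous d"
      using g by (simp add: subspace_scale)
    ultimately have "(l - fscale k x) * g + x * fscale k g \<in> ?S"
      by (intro span_add span_base) auto
    moreover have "(l - fscale k x) * g + x * fscale k g = l * g"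
      by (simp add: left_diff_distrib scale_mult[symmetric] scale_mult_right[symmetric])
    ultimately show "l * g \<in> ?S" by simp
  qed simp
  then show "ideal_part (span (insert x P)) (Suc d) \<subseteq> ?S" by simp
  have "ideal_part P (Suc d) \<subseteq> ideal_part (span (insert x P)) (Suc d)"
    unfolding ideal_part_Suc by (rule mult_span_mono) (auto intro: span_base)
  moreover have "(*) x ` homogeneous d \<subseteq> ideal_part (span (insert x P)) (Suc d)"
    unfolding ideal_part_Suc by (auto intro!: mult_in_mult_span span_base)
  ultimately show "?S \<subseteq> ideal_part (span (insert x P)) (Suc d)"
    by (intro span_minimal) auto
qed

definition generic_in where
  "generic_in i is P L x \<longleftrightarrow>
     x \<in> L i \<and> (\<forall>A\<subseteq>set (i # is). x \<in> span (join P L A) \<longrightarrow> L i \<subseteq> span (join P L A))"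

lemma exists_generic_in:
  assumes "subspace (L i)"
  shows "\<exists>x. generic_in i is P L x"
proof -
  have "\<exists>x\<in>L i. \<forall>U\<in>(\<lambda>A. span (join P L A)) ` Pow (set (i # is)). x \<in> U \<longrightarrow> L i \<subseteq> U"
    by (rule exists_generic_vector[OF infinite_field assms]) auto
  then show ?thesis unfolding generic_in_def by auto
qed

text \<open>
  The point of genericity.  If \<open>x \<notin> span (join P L A)\<close>, then \<open>x\<close> can be cancelled without loss of order.
  Otherwise \<open>L i \<subseteq> span (join P L A)\<close>, so \<open>A\<close> and \<open>insert i A\<close> have the same common zeros, and the order
  \<open>card A + 1\<close> known for \<open>insert i A\<close> makes up for the order lost by cancelling \<open>x\<close>.
\<close>
lemma vanishing_cancel_generic:
  assumes dist: "distinct (i # is)" and arr: "arrangement L (set (i # is))"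
    and P: "P \<subseteq> forms" and nP: "\<not> L i \<subseteq> span P"
    and x: "generic_in i is P L x" and g: "g \<in> homogeneous d"
    and van: "\<And>A. A \<subseteq> set (i # is) \<Longrightarrow> vanishes_to_order (card A) (join P L A) P (x * g)"
    and A: "A \<subseteq> set is"
  shows "vanishes_to_order (card A) (join P L A) P g"
proof -
  have xL: "x \<in> L i" and xf: "x \<in> forms" using x arr by (auto simp: generic_in_def)
  have U: "join P L A \<subseteq> forms" using join_subset_forms[OF P arr] A by auto
  have xP: "x \<notin> span P" using x nP unfolding generic_in_def by (metis UN_empty Un_empty_right empty_subsetI)
  show ?thesis
  proof (cases "x \<in> span (join P L A)")
    case False
    show ?thesis
      by (rule vanishes_to_order_cancel_nonvanishing[OF U xf False g])
        (use van[of A] A in auto)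
  next
    case True
    then have sub: "L i \<subseteq> span (join P L A)" using x A unfolding generic_in_def by auto
    have "finite A" "i \<notin> A" using A dist finite_subset by auto
    then have "vanishes_to_order (Suc (card A)) (join P L (insert i A)) P (x * g)"
      using van[of "insert i A"] A by auto
    moreover have "zeros (join P L A) \<subseteq> zeros (join P L (insert i A))"
    proof -
      have "join P L (insert i A) \<subseteq> span (join P L A)" using sub span_superset[of "join P L A"] by auto
      then have "zeros (span (join P L A)) \<subseteq> zeros (join P L (insert i A))" by (rule zeros_antimono)
      then show ?thesis by (simp only: zeros_span)
    qed
    ultimately have "vanishes_to_order (Suc (card A)) (join P L A) P (x * g)"
      by (rule vanishes_to_order_mono) simp
    then show ?thesis by (rule vanishes_to_order_cancel_transversal[OF P xf True xP g])
  qed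
qed

lemma forms_finite_span: "forms \<subseteq> span E" "finite E"
  by (simp add: forms_def, simp add: E_eq finite_B)

lemma codim_insert_less:
  assumes "subspace P" "P \<subseteq> forms" "x \<in> forms" "x \<notin> P"
  shows "dim forms - dim (span (insert x P)) < dim forms - dim P"
proof -
  have "dim (span (insert x P)) = dim P + 1"
    using dim_insert_notin_span[of x P E] assms forms_finite_span span_eq_iff[THEN iffD2, OF assms(1)]
    by auto
  moreover have "dim (insert x P) \<le> dim forms"
    using assms forms_finite_span by (intro dim_mono_finite_span[where F=E]) (auto simp: span_base)
  ultimately show ?thesis by simp
qed

text \<open>
  Primary decomposition of \<open>J + (P)\<close>, the inclusion that is not obvious.  The outer induction removes
  factors, the inner one enlarges \<open>P\<close> by generic elements of the first factor \<open>L i\<close> until \<open>P\<close> contains it;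
  in that case \<open>J + (P) = (P)\<close>, and the condition for \<open>A = {i}\<close> says that \<open>f\<close> vanishes on \<open>zeros P\<close>.
\<close>
theorem in_sum_part_if_vanishing:
  assumes "distinct is" "arrangement L (set is)" "subspace P" "P \<subseteq> forms" "f \<in> homogeneous d"
    and "\<And>A. A \<subseteq> set is \<Longrightarrow> vanishes_to_order (card A) (join P L A) P f"
  shows "f \<in> sum_part P L is d"
  using assms
proof (induction "is" arbitrary: P f d)
  case Nil
  then show ?case using product_part_subset_sum_part[of L "[]"] by auto
next
  case (Cons i "is")
  note outer = Cons.IH
  note dist = Cons.prems(1) and arr = Cons.prems(2)
  from Cons.prems(3-6) show ?case
  proof (induction "dim forms - dim P" arbitrary: P f d rule: less_induct)
    case less
    note P = less.prems(1,2) and f = less.prems(3) and van = less.prems(4)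
    have spP: "span P = P" using P by (simp add: span_eq_iff[THEN iffD2])
    show ?case
    proof (cases "L i \<subseteq> P")
      case True
      have "vanishes_to_order (Suc 0) (join P L {i}) P f" using van[of "{i}"] by simp
      moreover have "zeros P \<subseteq> zeros (join P L {i})" using True by (intro zeros_antimono) auto
      ultimately have "f v = 0" if "v \<in> zeros P" for v
        using vanishes_on_if_vanishes_to_order_Suc[OF P(2)] that by blast
      then have "f \<in> ideal_part P d" by (rule in_ideal_part_if_vanishing[OF P f])
      then show ?thesis using ideal_part_subset_sum_part by blast
    next
      case False
      obtain x where x: "generic_in i is P L x" using exists_generic_in[of L i "is" P] arr by auto
      have xL: "x \<in> L i" and xf: "x \<in> forms" using x arr by (auto simp: generic_in_def)
      have xP: "x \<notin> P" using x False spP unfolding generic_in_def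
        by (metis UN_empty Un_empty_right empty_subsetI)
      let ?P = "span (insert x P)"
      have PP: "P \<subseteq> ?P" using span_superset[of "insert x P"] by auto
      have "f \<in> sum_part ?P L (i # is) d"
      proof (rule less.hyps[OF codim_insert_less[OF P xf xP]])
        show "?P \<subseteq> forms" using P xf by (intro span_minimal) auto
        show "vanishes_to_order (card A) (join ?P L A) ?P f" if "A \<subseteq> set (i # is)" for A
          using van[OF that] by (rule vanishes_to_order_mono) (intro zeros_antimono; use PP in blast)+
      qed (simp_all add: f)
      then obtain j p' where jp: "j \<in> product_part forms L (i # is) d" "p' \<in> ideal_part ?P d" "f = j + p'"
        using in_sum_part_iff by blast
      show ?thesis
      proof (cases d)
        case 0
        then have "f = j" using jp(2,3) by simp
        then show ?thesis using jp(1) product_part_subset_sum_part by blast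
      next
        case (Suc e)
        then have "p' \<in> span (ideal_part P (Suc e) \<union> (*) x ` homogeneous e)"
          using jp(2) ideal_part_insert[OF P(1)] by simp
        moreover have sub: "subspace ((*) x ` homogeneous e)"
          by (rule subspaceI)
            (auto simp: subspace_0 scale_mult_right distrib_left[symmetric] subspace_add subspace_scale
              intro!: image_eqI[of 0 _ 0])
        ultimately obtain p g where pg: "p \<in> ideal_part P (Suc e)" "g \<in> homogeneous e" "p' = p + x * g"
          unfolding span_Un span_eq_iff[THEN iffD2, OF subspace_ideal_part] span_eq_iff[THEN iffD2, OF sub]
          by blast
        have jp_in: "j + p \<in> sum_part P L (i # is) d"
          using jp(1) pg(1) Suc in_sum_part_iff by blast
        \<comment> \<open>The elements \<open>j\<close> and \<open>p\<close> of \<open>J + (P)\<close> satisfy the vanishing conditions, hence so does \<open>x * g\<close>.\<close>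
        have "vanishes_to_order (card A) (join P L A) P (x * g)" if A: "A \<subseteq> set (i # is)" for A
        proof -
          have "f - (j + p) \<in> {h. vanishes_to_order (card A) (join P L A) P h}"
            using van[OF A] sum_part_vanishes[OF dist arr A P(2) jp_in]
            by (intro subspace_diff[OF subspace_vanishes_to_order]) auto
          moreover have "f - (j + p) = x * g" using jp(3) pg(3) by (simp add: algebra_simps)
          ultimately show ?thesis by simp
        qed
        then have "vanishes_to_order (card A) (join P L A) P g" if "A \<subseteq> set is" for A
          using vanishing_cancel_generic[OF dist arr P(2) _ x pg(2) _ that] False spP by simp
        then have "g \<in> sum_part P L is e"
          using dist arr by (intro outer[OF _ _ P pg(2)]) auto
        then have "x * g \<in> sum_part P L (i # is) (Suc e)"
          by (rule mult_in_sum_part[of x L i, OF xL xf])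
        then have "(j + p) + x * g \<in> sum_part P L (i # is) d"
          using subspace_add[OF subspace_sum_part jp_in] Suc by blast
        then show ?thesis using jp(3) pg(3) by (simp add: algebra_simps)
      qed
    qed
  qed
qed

section \<open>The Hilbert function depends only on the ranks\<close>
text \<open>
  Modulo \<open>P\<close>, a generic element of the first factor cancels that factor and nothing else: the primary
  decomposition translates membership into the conditions to which
  \<open>vanishing_cancel_generic\<close> applies.
\<close>
lemma colon_generic:
  assumes "distinct (i # is)" "arrangement L (set (i # is))" "subspace P" "P \<subseteq> forms"
    "\<not> L i \<subseteq> P" "generic_in i is P L x"
  shows "{g \<in> homogeneous d. x * g \<in> sum_part P L (i # is) (Suc d)} = sum_part P L is d"
proof
  have spP: "span P = P" using assms(3) by (simp add: span_eq_iff[THEN iffD2])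
  have xL: "x \<in> L i" and xf: "x \<in> forms" using assms by (auto simp: generic_in_def)
  show "sum_part P L is d \<subseteq> {g \<in> homogeneous d. x * g \<in> sum_part P L (i # is) (Suc d)}"
    using sum_part_subset_homogeneous[OF assms(4), of L "is"] assms(2) mult_in_sum_part[of x L i, OF xL xf]
    by auto
  show "{g \<in> homogeneous d. x * g \<in> sum_part P L (i # is) (Suc d)} \<subseteq> sum_part P L is d"
  proof
    fix g assume "g \<in> {g \<in> homogeneous d. x * g \<in> sum_part P L (i # is) (Suc d)}"
    then have g: "g \<in> homogeneous d" "x * g \<in> sum_part P L (i # is) (Suc d)" by auto
    have "vanishes_to_order (card A) (join P L A) P g" if "A \<subseteq> set is" for A
      using vanishing_cancel_generic[OF assms(1,2,4) _ assms(6) g(1) _ that]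
        sum_part_vanishes[OF assms(1,2) _ assms(4) g(2)] assms(5) spP by simp
    then show "g \<in> sum_part P L is d"
      using assms g(1) by (intro in_sum_part_if_vanishing) auto
  qed
qed

lemma linear_mult:
  fixes x :: "('b \<Rightarrow> 'k) \<Rightarrow> 'k"
  shows "Vector_Spaces.linear fscale fscale ((*) x)"
  unfolding Vector_Spaces.linear_iff
proof (intro conjI allI)
  show "x * (y + z) = x * y + x * z" for y z by (rule distrib_left)
  show "x * fscale c y = fscale c (x * y)" for c y by (rule scale_mult_right[symmetric])
qed (rule vector_space_axioms)+

lemma homogeneous_finite_span: "\<exists>G. finite G \<and> homogeneous d \<subseteq> span G"
  using power_part_finite_span[OF forms_finite_span] .

lemma sum_part_insert:
  assumes "subspace P"
  shows "sum_part (span (insert x P)) L is (Suc d)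
    = span (sum_part P L is (Suc d) \<union> (*) x ` homogeneous d)"
  unfolding sum_part_def ideal_part_insert[OF assms]
  by (simp only: span_Un_span_right span_Un_span_left Un_assoc)

text \<open>
  Multiplication by \<open>x\<close> from degree \<open>d\<close> to degree \<open>d + 1\<close>, followed by reduction modulo \<open>J + (P)\<close>, has kernel
  \<open>(J : x) + (P)\<close>, and its image is the ideal generated by \<open>x\<close> modulo \<open>J + (P)\<close>.
\<close>
theorem dim_sum_part_recursion:
  assumes "distinct (i # is)" "arrangement L (set (i # is))" "subspace P" "P \<subseteq> forms"
    "\<not> L i \<subseteq> P" "generic_in i is P L x"
  shows "dim (sum_part P L (i # is) (Suc d)) + dim (homogeneous d)
    = dim (sum_part (span (insert x P)) L (i # is) (Suc d)) + dim (sum_part P L is d)"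
proof -
  obtain F where F: "finite F" "homogeneous (Suc d) \<subseteq> span F" using homogeneous_finite_span by blast
  obtain G where G: "finite G" "homogeneous d \<subseteq> span G" using homogeneous_finite_span by blast
  have "sum_part P L (i # is) (Suc d) \<subseteq> span F"
    using sum_part_subset_homogeneous[OF assms(4,2)] F(2) by blast
  from dim_preimage_add_dim_image[OF linear_mult[of x] subspace_sum_part this F(1) subspace_power_part G(2,1)]
  show ?thesis unfolding colon_generic[OF assms] sum_part_insert[OF assms(3)] by simp
qed

text \<open>
  A form outside \<open>P\<close> is a nonzerodivisor modulo the prime ideal \<open>(P)\<close>.
\<close>
lemma colon_ideal_part:
  assumes "subspace P" "P \<subseteq> forms" "x \<in> forms" "x \<notin> P"
  shows "{g \<in> homogeneous d. x * g \<in> ideal_part P (Suc d)} = ideal_part P d"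
proof
  show "ideal_part P d \<subseteq> {g \<in> homogeneous d. x * g \<in> ideal_part P (Suc d)}"
    using ideal_part_subset[OF assms(2)] mult_in_ideal_part[OF assms(3)] by auto
  show "{g \<in> homogeneous d. x * g \<in> ideal_part P (Suc d)} \<subseteq> ideal_part P d"
  proof
    fix g assume "g \<in> {g \<in> homogeneous d. x * g \<in> ideal_part P (Suc d)}"
    then have g: "g \<in> homogeneous d" "x * g \<in> ideal_part P (Suc d)" by auto
    have xP: "x \<notin> span P" using assms(1,4) by (simp add: span_eq_iff[THEN iffD2])
    have "vanishes_to_order (Suc 0) P P g"
      by (rule vanishes_to_order_cancel_nonvanishing[OF assms(2,3) xP g(1)
          ideal_part_vanishes[OF assms(2) subset_refl g(2)]])
    then show "g \<in> ideal_part P d"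
      using vanishes_on_if_vanishes_to_order_Suc[OF assms(2) subset_refl]
      by (intro in_ideal_part_if_vanishing assms(1,2) g(1)) blast
  qed
qed

lemma dim_ideal_part_recursion:
  assumes "subspace P" "P \<subseteq> forms" "x \<in> forms" "x \<notin> P"
  shows "dim (ideal_part (span (insert x P)) (Suc d)) + dim (ideal_part P d)
    = dim (ideal_part P (Suc d)) + dim (homogeneous d)"
proof -
  obtain F where F: "finite F" "homogeneous (Suc d) \<subseteq> span F" using homogeneous_finite_span by blast
  obtain G where G: "finite G" "homogeneous d \<subseteq> span G" using homogeneous_finite_span by blast
  have "ideal_part P (Suc d) \<subseteq> span F"
    using ideal_part_subset[OF assms(2)] F(2) by blast
  from dim_preimage_add_dim_image[OF linear_mult[of x] subspace_ideal_part this F(1) subspace_power_part G(2,1)]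
  show ?thesis unfolding colon_ideal_part[OF assms] ideal_part_insert[OF assms(1)] .
qed

lemma dim_ideal_part_cong_basis:
  assumes "finite C" "independent C" "C \<subseteq> forms" "independent C'" "C' \<subseteq> forms" "card C = card C'" "finite C'"
  shows "dim (ideal_part (span C) d) = dim (ideal_part (span C') d)"
  using assms
proof (induction C arbitrary: C' d rule: finite_induct)
  case empty
  then show ?case by simp
next
  case (insert c C)
  obtain c' D where D: "C' = insert c' D" "c' \<notin> D" "card D = card C"
    using insert.prems(5) insert.hyps by (metis card_Suc_eq card_insert_disjoint)
  have finD: "finite D" using D(1) insert.prems(6) by simp
  have ind: "independent C" "independent D"
    using insert.prems(1,3) D(1) independent_mono by blast+
  have notin: "c \<notin> span C" "c' \<notin> span D"
    using insert.prems(1,3) D insert.hyps(2) by (simp_all add: independent_insert)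
  have "C \<subseteq> forms" "D \<subseteq> forms" using insert.prems(2,4) D(1) by auto
  then have sub: "span C \<subseteq> forms" "span D \<subseteq> forms" "c \<in> forms" "c' \<in> forms"
    using insert.prems(2,4) D(1) by (simp_all add: span_minimal)
  have IH: "dim (ideal_part (span C) e) = dim (ideal_part (span D) e)" for e
    using insert.prems D by (intro insert.IH[OF ind(1) _ ind(2) _ _ finD]) auto
  have spans: "span (insert c C) = span (insert c (span C))" "span C' = span (insert c' (span D))"
    using span_Un_span_right[of "{c}" C] span_Un_span_right[of "{c'}" D] D(1) by simp_all
  show ?case
  proof (cases d)
    case 0
    then show ?thesis by simp
  next
    case (Suc e)
    show ?thesis
      unfolding spans Suc
      using dim_ideal_part_recursion[OF subspace_span sub(1,3) notin(1), of e]
        dim_ideal_part_recursion[OF subspace_span sub(2,4) notin(2), of e] IH[of e] IH[of "Suc e"]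
      by linarith
  qed
qed

lemma dim_ideal_part_cong:
  assumes P: "subspace P" "P \<subseteq> forms" and P': "subspace P'" "P' \<subseteq> forms" and "dim P = dim P'"
  shows "dim (ideal_part P d) = dim (ideal_part P' d)"
proof -
  obtain C where C: "C \<subseteq> P" "independent C" "P \<subseteq> span C"
    using maximal_independent_subset by blast
  obtain C' where C': "C' \<subseteq> P'" "independent C'" "P' \<subseteq> span C'"
    using maximal_independent_subset by blast
  have fin: "finite C" "finite C'"
    using independent_span_bound[OF forms_finite_span(2) C(2)]
      independent_span_bound[OF forms_finite_span(2) C'(2)] C(1) C'(1) P(2) P'(2) forms_finite_span(1)
    by (meson subset_trans)+
  have "card C = card C'"
    using basis_card_eq_dim[OF C(1,3,2)] basis_card_eq_dim[OF C'(1,3,2)] assms(5) by simp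
  then have "dim (ideal_part (span C) d) = dim (ideal_part (span C') d)"
    using C(1) C'(1) P(2) P'(2) fin
    by (intro dim_ideal_part_cong_basis C(2) C'(2)) (auto simp: subset_trans)
  then show ?thesis
    using span_subspace[OF C(1,3) P(1)] span_subspace[OF C'(1,3) P'(1)] by simp
qed

lemma dim_insert_form:
  assumes "S \<subseteq> forms"
  shows "dim (insert x S) = dim S + (if x \<in> span S then 0 else 1)"
proof (cases "x \<in> span S")
  case True
  then have "dim (insert x S) = dim S" by (intro span_eq_dim span_redundant)
  then show ?thesis using True by simp
next
  case False
  then show ?thesis
    using dim_insert_notin_span[OF False _ forms_finite_span(2)] assms forms_finite_span(1) by auto
qed

text \<open>
  Turns the inclusions on which the recursion depends into equations between ranks.
\<close>
lemma subset_span_iff_dim_eq: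
  assumes "S \<subseteq> forms" "L \<subseteq> forms"
  shows "L \<subseteq> span S \<longleftrightarrow> dim (S \<union> L) = dim S"
proof
  assume "L \<subseteq> span S"
  then have "span (S \<union> L) = span S"
    by (intro subset_antisym span_minimal span_mono) (auto intro: span_base)
  then show "dim (S \<union> L) = dim S" by (rule span_eq_dim)
next
  assume eq: "dim (S \<union> L) = dim S"
  show "L \<subseteq> span S"
  proof
    fix x assume x: "x \<in> L"
    have "dim (insert x S) \<le> dim (S \<union> L)"
      using x assms forms_finite_span by (intro dim_mono_finite_span[where F=E]) (auto intro: span_base)
    then show "x \<in> span S" using eq dim_insert_form[OF assms(1), of x] by (auto split: if_splits)
  qed
qed

lemma span_join_span_insert: "span (join (span (insert x P)) L A) = span (insert x (join P L A))"
  by (simp only: span_Un_span_left Un_insert_left)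

lemma dim_join_span_insert:
  assumes "P \<subseteq> forms" "arrangement L I" "A \<subseteq> I"
  shows "dim (join (span (insert x P)) L A)
    = dim (join P L A) + (if x \<in> span (join P L A) then 0 else 1)"
  unfolding span_eq_dim[OF span_join_span_insert]
  by (rule dim_insert_form[OF join_subset_forms[OF assms]])

lemma generic_in_span_join_iff:
  assumes x: "generic_in i is P L x" and "P \<subseteq> forms" "arrangement L (set (i # is))" "A \<subseteq> set (i # is)"
  shows "x \<in> span (join P L A) \<longleftrightarrow> dim (join P L (insert i A)) = dim (join P L A)"
proof -
  have "x \<in> span (join P L A) \<longleftrightarrow> L i \<subseteq> span (join P L A)"
    using x assms(4) unfolding generic_in_def by blast
  also have "\<dots> \<longleftrightarrow> dim (join P L A \<union> L i) = dim (join P L A)"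
    using assms by (intro subset_span_iff_dim_eq join_subset_forms[OF assms(2-4)]) auto
  also have "join P L A \<union> L i = join P L (insert i A)" by auto
  finally show ?thesis .
qed

text \<open>
  The recursion is run in parallel for both families, with generic elements \<open>x\<close> and \<open>x'\<close>.  The rank of
  \<open>join P L A\<close> grows when \<open>x\<close> is added to \<open>P\<close> unless \<open>x \<in> span (join P L A)\<close>, and by genericity this happens
  exactly if adding \<open>L i\<close> does not change the rank.  So the ranks stay equal after the step.
\<close>
theorem dim_sum_part_cong:
  fixes L L' :: "'c \<Rightarrow> (('b \<Rightarrow> 'k) \<Rightarrow> 'k) set"
  assumes "distinct is" "arrangement L (set is)" "arrangement L' (set is)"
    and "subspace P" "P \<subseteq> forms" "subspace P'" "P' \<subseteq> forms"
    and "\<And>A. A \<subseteq> set is \<Longrightarrow> dim (join P L A) = dim (join P' L' A)"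
  shows "dim (sum_part P L is d) = dim (sum_part P' L' is d)"
  using assms
proof (induction "is" arbitrary: P P' d)
  case Nil
  have "sum_part P L [] d = homogeneous d" if "P \<subseteq> forms" for P and L :: "'c \<Rightarrow> _ set"
    unfolding sum_part_def using ideal_part_subset[OF that, of d]
    by (simp add: Un_absorb2)
  then show ?case using Nil by simp
next
  case (Cons i "is")
  note outer = Cons.IH
  note dist = Cons.prems(1) and arr = Cons.prems(2) and arr' = Cons.prems(3)
  from Cons.prems(4-8) show ?case
  proof (induction "dim forms - dim P" arbitrary: P P' d rule: less_induct)
    case less
    note P = less.prems(1,2) and P' = less.prems(3,4) and ranks = less.prems(5)
    have sp: "span P = P" "span P' = P'" using P P' by (simp_all add: span_eq_iff[THEN iffD2])
    have in_P: "L i \<subseteq> P \<longleftrightarrow> L' i \<subseteq> P'"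
      using subset_span_iff_dim_eq[of P "L i"] subset_span_iff_dim_eq[of P' "L' i"]
        ranks[of "{}"] ranks[of "{i}"] P P' arr arr' sp by simp
    show ?case
    proof (cases "L i \<subseteq> P")
      case True
      have collapse: "sum_part P L (i # is) d = ideal_part P d"
        if "L i \<subseteq> P" "arrangement L (set (i # is))" for P L
      proof -
        have "product_part forms L is e \<subseteq> homogeneous e" for e
          using that(2) by (intro product_part_subset_power_part) (auto simp: arrangement_def)
        then have "product_part forms L (i # is) d \<subseteq> ideal_part P d"
          using that(1) by (cases d) (simp_all add: mult_span_mono)
        then show ?thesis unfolding sum_part_def
          by (simp add: Un_absorb1 span_eq_iff[THEN iffD2])
      qed
      have "dim P = dim P'" using ranks[of "{}"] by simp
      then show ?thesis
        unfolding collapse[OF True arr] collapse[OF in_P[THEN iffD1, OF True] arr']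
        by (rule dim_ideal_part_cong[OF P P'])
    next
      case False
      then have False': "\<not> L' i \<subseteq> P'" using in_P by simp
      obtain x where x: "generic_in i is P L x" using exists_generic_in[of L i "is" P] arr by auto
      obtain x' where x': "generic_in i is P' L' x'" using exists_generic_in[of L' i "is" P'] arr' by auto
      have xf: "x \<in> forms" "x' \<in> forms" using x x' arr arr' by (auto simp: generic_in_def)
      have xP: "x \<notin> P" using x False sp unfolding generic_in_def
        by (metis UN_empty Un_empty_right empty_subsetI)
      let ?P = "span (insert x P)" and ?P' = "span (insert x' P')"
      have "dim (join ?P L A) = dim (join ?P' L' A)" if A: "A \<subseteq> set (i # is)" for A
        using generic_in_span_join_iff[OF x P(2) arr A] generic_in_span_join_iff[OF x' P'(2) arr' A]
          ranks[OF A] ranks[of "insert i A"] A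
          dim_join_span_insert[OF P(2) arr A, of x] dim_join_span_insert[OF P'(2) arr' A, of x']
        by simp
      then have IH: "dim (sum_part ?P L (i # is) e) = dim (sum_part ?P' L' (i # is) e)" for e
        using P P' xf
        by (intro less.hyps[OF codim_insert_less[OF P xf(1) xP]] subspace_span span_minimal) auto
      have IH': "dim (sum_part P L is e) = dim (sum_part P' L' is e)" for e
        using dist arr arr' P P' ranks by (intro outer) auto
      show ?thesis
      proof (cases d)
        case 0
        then show ?thesis by (simp add: sum_part_def)
      next
        case (Suc e)
        then show ?thesis
          using dim_sum_part_recursion[OF dist arr P False x, of e]
            dim_sum_part_recursion[OF dist arr' P' False' x', of e] IH[of "Suc e"] IH'[of e]
          by simp
      qed
    qed
  qed
qed

corollary dim_product_part_cong:
  fixes L L' :: "'c \<Rightarrow> (('b \<Rightarrow> 'k) \<Rightarrow> 'k) set"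
  assumes "distinct is" "arrangement L (set is)" "arrangement L' (set is)"
    and "\<And>A. A \<subseteq> set is \<Longrightarrow> dim (\<Union>i\<in>A. L i) = dim (\<Union>i\<in>A. L' i)"
  shows "dim (product_part forms L is d) = dim (product_part forms L' is d)"
proof -
  have zero: "mult_span {0} M = {0}" for M
    using mult_span_subset[of "{0}" "{0}" M] subspace_0[OF subspace_mult_span, of "{0}" M] by auto
  have ideal: "ideal_part {0} d = {0}" by (cases d) (simp_all add: zero)
  have "sum_part {0} L is d = product_part forms L is d" for L :: "'c \<Rightarrow> _ set"
    unfolding sum_part_def ideal
    by (simp add: insert_absorb subspace_0 span_eq_iff[THEN iffD2])
  moreover have "dim (join {0} L A) = dim (\<Union>i\<in>A. L i)" for L :: "'c \<Rightarrow> _ set" and A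
    by (rule span_eq_dim) simp
  ultimately show ?thesis
    using dim_sum_part_cong[OF assms(1-3), of "{0}" "{0}" d] assms(4)
    by (simp add: subspace_0)
qed

end


section \<open>Extension of the coefficient field\<close>
locale base_change =
  A: commutative_algebra scale + A': commutative_algebra scale'
  for scale :: "'k::field \<Rightarrow> 'a::comm_ring_1 \<Rightarrow> 'a"
    and scale' :: "'l::field \<Rightarrow> 'c::comm_ring_1 \<Rightarrow> 'c" +
  fixes \<iota> :: "'k \<Rightarrow> 'l" and \<Phi> :: "'a \<Rightarrow> 'c"
  assumes hom_add: "\<Phi> (x + y) = \<Phi> x + \<Phi> y"
    and hom_mult: "\<Phi> (x * y) = \<Phi> x * \<Phi> y"
    and hom_one: "\<Phi> 1 = 1"
    and hom_scale: "\<Phi> (scale c x) = scale' (\<iota> c) (\<Phi> x)"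
begin

lemma hom_zero: "\<Phi> 0 = 0"
  using hom_add[of 0 0] by simp

lemma hom_span: "x \<in> A.span S \<Longrightarrow> \<Phi> x \<in> A'.span (\<Phi> ` S)"
proof (induction rule: A.span_induct_alt)
  case base
  then show ?case by (simp add: hom_zero A'.span_zero)
next
  case (step c x y)
  then show ?case
    by (simp add: hom_add hom_scale A'.span_add A'.span_scale A'.span_base)
qed

lemma span_image_span: "A'.span (\<Phi> ` A.span S) = A'.span (\<Phi> ` S)"
proof
  show "A'.span (\<Phi> ` A.span S) \<subseteq> A'.span (\<Phi> ` S)"
    using hom_span by (intro A'.span_minimal) auto
  show "A'.span (\<Phi> ` S) \<subseteq> A'.span (\<Phi> ` A.span S)"
    by (intro A'.span_mono image_mono A.span_superset)
qed

lemma mult_span_image: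
  "A'.mult_span (A'.span (\<Phi> ` L)) (A'.span (\<Phi> ` M)) = A'.span (\<Phi> ` A.mult_span L M)"
proof -
  have "{a * c |a c. a \<in> \<Phi> ` L \<and> c \<in> \<Phi> ` M} = \<Phi> ` {l * g |l g. l \<in> L \<and> g \<in> M}"
    by (auto simp: image_iff hom_mult) (metis hom_mult)+
  then show ?thesis by (simp add: A'.mult_span_span A.mult_span_def span_image_span)
qed

lemma power_part_image: "A'.power_part (A'.span (\<Phi> ` X)) d = A'.span (\<Phi> ` A.power_part X d)"
proof (induction d)
  case 0
  show ?case by (simp add: span_image_span hom_one)
next
  case (Suc d)
  then show ?case by (simp add: mult_span_image)
qed

lemma product_part_image:
  "A'.product_part (A'.span (\<Phi> ` X)) (\<lambda>i. A'.span (\<Phi> ` L i)) is d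
    = A'.span (\<Phi> ` A.product_part X L is d)"
proof (induction "is" arbitrary: d)
  case Nil
  then show ?case by (simp add: power_part_image)
next
  case (Cons i "is")
  then show ?case by (cases d) (simp_all add: mult_span_image hom_zero)
qed

lemma dim_span_image:
  assumes "\<And>F. F \<subseteq> S \<Longrightarrow> A.independent F \<Longrightarrow> inj_on \<Phi> F \<and> A'.independent (\<Phi> ` F)"
  shows "A'.dim (A'.span (\<Phi> ` S)) = A.dim S"
proof -
  obtain F where F: "F \<subseteq> S" "A.independent F" "S \<subseteq> A.span F"
    using A.maximal_independent_subset by blast
  have "A'.span (\<Phi> ` S) = A'.span (\<Phi> ` F)"
  proof
    show "A'.span (\<Phi> ` S) \<subseteq> A'.span (\<Phi> ` F)"
      using F(3) hom_span by (intro A'.span_minimal) auto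
    show "A'.span (\<Phi> ` F) \<subseteq> A'.span (\<Phi> ` S)"
      using F(1) by (intro A'.span_mono) auto
  qed
  then have "A'.dim (A'.span (\<Phi> ` S)) = card (\<Phi> ` F)"
    using assms[OF F(1,2)] by (simp add: A'.dim_eq_card_independent)
  also have "\<dots> = card F" using assms[OF F(1,2)] by (simp add: card_image)
  also have "\<dots> = A.dim S" using A.basis_card_eq_dim[OF F(1,3,2)] .
  finally show ?thesis .
qed

end

text \<open>
  Distinct monomials are linearly independent functions over an infinite field.  In the induction, the
  monomials with a given exponent at the new variable \<open>b\<close> form a coefficient of a polynomial in that variable
  which vanishes identically.  Monomials are indexed by an arbitrary set, so those with the same exponent at
  \<open>b\<close> can be used unchanged for the smaller set of variables.
\<close>
lemma monomial_functions_independent: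
  fixes a :: "'i \<Rightarrow> 'c::field" and ex :: "'i \<Rightarrow> 'b \<Rightarrow> nat"
  assumes inf: "infinite (UNIV :: 'c set)" and "finite B" "finite M"
    and "\<And>i j. i \<in> M \<Longrightarrow> j \<in> M \<Longrightarrow> (\<And>b. b \<in> B \<Longrightarrow> ex i b = ex j b) \<Longrightarrow> i = j"
    and "\<And>v. (\<Sum>i\<in>M. a i * (\<Prod>b\<in>B. v b ^ ex i b)) = 0"
    and "i \<in> M"
  shows "a i = 0"
  using assms(2-6)
proof (induction B arbitrary: M rule: finite_induct)
  case empty
  have "j = i" if "j \<in> M" for j using empty.prems(2)[OF that empty.prems(4)] by simp
  then have "M = {i}" using empty.prems(4) by blast
  then show ?case using empty.prems(3) by simp
next
  case (insert b B)
  let ?M = "{j \<in> M. ex j b = ex i b}"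
  have "(\<Sum>j\<in>?M. a j * (\<Prod>b\<in>B. v b ^ ex j b)) = 0" for v
  proof -
    define p where "p = (\<Sum>j\<in>M. monom (a j * (\<Prod>b\<in>B. v b ^ ex j b)) (ex j b))"
    have "poly p t = 0" for t
    proof -
      have "(\<Prod>b'\<in>insert b B. (v(b := t)) b' ^ ex j b') = t ^ ex j b * (\<Prod>b\<in>B. v b ^ ex j b)" for j
      proof -
        have "(\<Prod>b'\<in>B. (v(b := t)) b' ^ ex j b') = (\<Prod>b\<in>B. v b ^ ex j b)"
          using insert.hyps(2) by (intro prod.cong) auto
        then show ?thesis using insert.hyps by simp
      qed
      then show ?thesis using insert.prems(3)[of "v(b := t)"]
        by (simp add: p_def poly_sum poly_monom mult_ac)
    qed
    then have "p = 0" by (intro poly_eqI_infinite[OF inf]) simp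
    then have "(\<Sum>j\<in>M. if ex j b = ex i b then a j * (\<Prod>b\<in>B. v b ^ ex j b) else 0) = 0"
      using arg_cong[of p 0 "\<lambda>p. coeff p (ex i b)"] unfolding p_def coeff_sum coeff_monom by simp
    then show ?thesis using insert.prems(1) by (simp add: sum.inter_filter)
  qed
  then show ?case
  proof (intro insert.IH[of ?M])
    fix j l assume jl: "j \<in> ?M" "l \<in> ?M" "\<And>b'. b' \<in> B \<Longrightarrow> ex j b' = ex l b'"
    have "ex j b' = ex l b'" if "b' \<in> insert b B" for b'
      using that jl by (cases "b' = b") auto
    then show "j = l" using insert.prems(2)[of j l] jl(1,2) by blast
  qed (use insert.prems in auto)
qed

text \<open>
  The polynomial function of \<open>p\<close> over the larger field, with its variables renamed along \<open>e\<close>.  The renaming brings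
  polynomial rings with different sets of variables into a common ring of functions.
\<close>
definition evaluate ::
    "('k::field \<Rightarrow> 'l::field) \<Rightarrow> ('v \<Rightarrow> 'b) \<Rightarrow> 'v set \<Rightarrow> ('v, 'k) mpoly \<Rightarrow> ('b \<Rightarrow> 'l) \<Rightarrow> 'l" where
  "evaluate \<iota> e B p = (\<lambda>v. \<Sum>\<mu>\<in>Poly_Mapping.keys p.
     \<iota> (Poly_Mapping.lookup p \<mu>) * (\<Prod>b\<in>B. v (e b) ^ Poly_Mapping.lookup \<mu> b))"

lemma lookup_poly_scale [simp]:
  "Poly_Mapping.lookup (poly_scale c p) \<mu> = c * Poly_Mapping.lookup p \<mu>"
  unfolding poly_scale_def mult_map_scale_conv_mult[symmetric]
  by (simp add: map.rep_eq when_def)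

lemma commutative_algebra_poly_scale:
  "commutative_algebra (poly_scale :: 'k::field \<Rightarrow> ('v, 'k) mpoly \<Rightarrow> ('v, 'k) mpoly)"
proof -
  interpret vector_space "poly_scale :: 'k \<Rightarrow> ('v, 'k) mpoly \<Rightarrow> ('v, 'k) mpoly"
    by (rule vector_space_poly_scale)
  show ?thesis by standard (simp add: poly_scale_def mult.assoc)
qed

lemma mpoly_sum_monomials:
  "p = (\<Sum>\<mu>\<in>Poly_Mapping.keys p. Poly_Mapping.single \<mu> (Poly_Mapping.lookup p \<mu>))"
proof (rule poly_mapping_eqI)
  fix \<nu>
  show "Poly_Mapping.lookup p \<nu>
    = Poly_Mapping.lookup (\<Sum>\<mu>\<in>Poly_Mapping.keys p. Poly_Mapping.single \<mu> (Poly_Mapping.lookup p \<mu>)) \<nu>"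
    by (cases "\<nu> \<in> Poly_Mapping.keys p") (auto simp: lookup_sum lookup_single when_def in_keys_iff)
qed

locale coefficient_extension =
  fixes \<iota> :: "'k::field \<Rightarrow> 'l::field"
  assumes \<iota>_add: "\<iota> (x + y) = \<iota> x + \<iota> y"
    and \<iota>_mult: "\<iota> (x * y) = \<iota> x * \<iota> y"
    and \<iota>_one: "\<iota> 1 = 1"
begin

lemma \<iota>_zero: "\<iota> 0 = 0"
  using \<iota>_add[of 0 0] by (metis add.right_neutral add_left_cancel)

lemma evaluate_eq:
  assumes "finite M" "Poly_Mapping.keys p \<subseteq> M"
  shows "evaluate \<iota> e B p v
    = (\<Sum>\<mu>\<in>M. \<iota> (Poly_Mapping.lookup p \<mu>) * (\<Prod>b\<in>B. v (e b) ^ Poly_Mapping.lookup \<mu> b))"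
  unfolding evaluate_def using assms
  by (intro sum.mono_neutral_left) (auto simp: in_keys_iff \<iota>_zero)

lemma evaluate_single:
  "evaluate \<iota> e B (Poly_Mapping.single \<mu> c) v = \<iota> c * (\<Prod>b\<in>B. v (e b) ^ Poly_Mapping.lookup \<mu> b)"
  by (subst evaluate_eq[of "{\<mu>}"]) auto

lemma evaluate_add: "evaluate \<iota> e B (p + q) v = evaluate \<iota> e B p v + evaluate \<iota> e B q v"
proof -
  let ?M = "Poly_Mapping.keys p \<union> Poly_Mapping.keys q"
  have "finite ?M" "Poly_Mapping.keys p \<subseteq> ?M" "Poly_Mapping.keys q \<subseteq> ?M" "Poly_Mapping.keys (p + q) \<subseteq> ?M"
    using keys_add[of p q] by auto
  then show ?thesis
    by (simp add: evaluate_eq[of ?M] lookup_add \<iota>_add distrib_right sum.distrib)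
qed

lemma evaluate_zero: "evaluate \<iota> e B 0 v = 0"
  by (simp add: evaluate_def)

lemma evaluate_sum: "evaluate \<iota> e B (sum f M) v = (\<Sum>i\<in>M. evaluate \<iota> e B (f i) v)"
  by (induction M rule: infinite_finite_induct) (simp_all add: evaluate_add evaluate_zero)

lemma evaluate_mult: "evaluate \<iota> e B (p * q) v = evaluate \<iota> e B p v * evaluate \<iota> e B q v"
proof -
  let ?m = "\<lambda>p \<mu>. Poly_Mapping.single \<mu> (Poly_Mapping.lookup p \<mu>)"
  have single: "evaluate \<iota> e B (?m p \<mu> * ?m q \<nu>) v
      = evaluate \<iota> e B (?m p \<mu>) v * evaluate \<iota> e B (?m q \<nu>) v" for \<mu> \<nu>
    by (simp add: mult_single evaluate_single lookup_add power_add prod.distrib \<iota>_mult mult_ac)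
  have "evaluate \<iota> e B (p * q) v = evaluate \<iota> e B
      ((\<Sum>\<mu>\<in>Poly_Mapping.keys p. ?m p \<mu>) * (\<Sum>\<nu>\<in>Poly_Mapping.keys q. ?m q \<nu>)) v"
    using mpoly_sum_monomials[of p] mpoly_sum_monomials[of q] by simp
  also have "\<dots> = evaluate \<iota> e B (\<Sum>\<mu>\<in>Poly_Mapping.keys p. ?m p \<mu>) v
      * evaluate \<iota> e B (\<Sum>\<nu>\<in>Poly_Mapping.keys q. ?m q \<nu>) v"
    unfolding sum_product evaluate_sum single ..
  also have "\<dots> = evaluate \<iota> e B p v * evaluate \<iota> e B q v"
    using mpoly_sum_monomials[of p] mpoly_sum_monomials[of q] by simp
  finally show ?thesis .
qed

lemma base_change_evaluate:
  "base_change poly_scale fscale \<iota> (evaluate \<iota> e B :: ('v, 'k) mpoly \<Rightarrow> ('b \<Rightarrow> 'l) \<Rightarrow> 'l)"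
proof (intro base_change.intro commutative_algebra_poly_scale commutative_algebra_fscale
    base_change_axioms.intro ext)
  fix x y :: "('v, 'k) mpoly" and v :: "'b \<Rightarrow> 'l" and c
  show "evaluate \<iota> e B (x + y) v = (evaluate \<iota> e B x + evaluate \<iota> e B y) v"
    by (simp add: evaluate_add fun_apply)
  show "evaluate \<iota> e B (x * y) v = (evaluate \<iota> e B x * evaluate \<iota> e B y) v"
    by (simp add: evaluate_mult fun_apply)
  show "evaluate \<iota> e B (1 :: ('v, 'k) mpoly) v = 1 v"
    using evaluate_single[of e B 0 1 v] by (simp add: fun_apply \<iota>_one)
  show "evaluate \<iota> e B (poly_scale c x) v = fscale (\<iota> c) (evaluate \<iota> e B x) v"
    by (simp add: poly_scale_def evaluate_mult evaluate_single fun_apply)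
qed

lemma vector_space_coefficients: "vector_space (\<lambda>a x. \<iota> a * x)"
  by standard (simp_all add: \<iota>_add \<iota>_mult \<iota>_one algebra_simps)

text \<open>
  Polynomials that are independent over the small field stay independent over the large one.  Suppose that
  they satisfy a relation with coefficients \<open>c f\<close>, where \<open>c g \<noteq> 0\<close>.  A functional \<open>h\<close> of the large field over the
  small one with \<open>h (c g) = 1\<close>, applied to each monomial coefficient of the relation, gives a nontrivial relation
  over the small field.
\<close>
lemma evaluate_independent:
  fixes e :: "'v \<Rightarrow> 'b" and F :: "('v, 'k) mpoly set"
  assumes inf: "infinite (UNIV :: 'l set)" and B: "finite B" "inj_on e B"
    and F: "F \<subseteq> carrier (coord_ring B)" "\<not> module.dependent poly_scale F"
    and T: "finite T" "T \<subseteq> F"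
    and zero: "\<And>v. (\<Sum>f\<in>T. c f * evaluate \<iota> e B f v) = 0"
    and g: "g \<in> T"
  shows "c g = 0"
proof (rule ccontr)
  assume "c g \<noteq> 0"
  interpret mp: vector_space "poly_scale :: 'k \<Rightarrow> ('v, 'k) mpoly \<Rightarrow> ('v, 'k) mpoly"
    by (rule vector_space_poly_scale)
  interpret l: vector_space "\<lambda>a x. \<iota> a * x" by (rule vector_space_coefficients)
  obtain h where h: "Vector_Spaces.linear (\<lambda>a x. \<iota> a * x) (*) h" "h (c g) = 1"
    using l.exists_functional_separating[OF l.subspace_single_0, of "c g"] \<open>c g \<noteq> 0\<close> by auto
  interpret h: Vector_Spaces.linear "\<lambda>a x. \<iota> a * x" "(*)" h by (rule h(1))
  let ?M = "\<Union>f\<in>T. Poly_Mapping.keys f"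
  let ?a = "\<lambda>\<mu>. \<Sum>f\<in>T. c f * \<iota> (Poly_Mapping.lookup f \<mu>)"
  have finM: "finite ?M" using T(1) by simp
  have supp: "Poly_Mapping.lookup \<mu> b = 0" if "\<mu> \<in> ?M" "b \<notin> B" for \<mu> b
  proof -
    have "Poly_Mapping.keys \<mu> \<subseteq> B" using that(1) T(2) F(1) by (fastforce simp: coord_ring_def)
    then show ?thesis using that(2) by (auto simp: in_keys_iff)
  qed
  have a0: "?a \<mu> = 0" if "\<mu> \<in> ?M" for \<mu>
  proof (rule monomial_functions_independent[OF inf B(1) finM _ _ that, of Poly_Mapping.lookup])
    fix \<mu> \<nu> assume "\<mu> \<in> ?M" "\<nu> \<in> ?M" "\<And>b. b \<in> B \<Longrightarrow> Poly_Mapping.lookup \<mu> b = Poly_Mapping.lookup \<nu> b"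
    then show "\<mu> = \<nu>" using supp by (intro poly_mapping_eqI) metis
  next
    fix v :: "'v \<Rightarrow> 'l"
    \<comment> \<open>Values prescribed on \<open>B\<close> are attained by a point of the renamed space, as \<open>e\<close> is injective on \<open>B\<close>.\<close>
    let ?v = "\<lambda>n. v (inv_into B e n)"
    have ev: "evaluate \<iota> e B f ?v
        = (\<Sum>\<mu>\<in>?M. \<iota> (Poly_Mapping.lookup f \<mu>) * (\<Prod>b\<in>B. v b ^ Poly_Mapping.lookup \<mu> b))"
      if "f \<in> T" for f
      using that by (subst evaluate_eq[OF finM]) (auto simp: B(2) intro!: sum.cong prod.cong)
    have "0 = (\<Sum>f\<in>T. \<Sum>\<mu>\<in>?M. c f * \<iota> (Poly_Mapping.lookup f \<mu>) * (\<Prod>b\<in>B. v b ^ Poly_Mapping.lookup \<mu> b))"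
      using zero[of ?v] ev by (simp add: sum_distrib_left mult.assoc)
    also have "\<dots> = (\<Sum>\<mu>\<in>?M. ?a \<mu> * (\<Prod>b\<in>B. v b ^ Poly_Mapping.lookup \<mu> b))"
      by (subst sum.swap) (simp add: sum_distrib_right)
    finally show "(\<Sum>\<mu>\<in>?M. ?a \<mu> * (\<Prod>b\<in>B. v b ^ Poly_Mapping.lookup \<mu> b)) = 0" by simp
  qed
  have "(\<Sum>f\<in>T. poly_scale (h (c f)) f) = 0"
  proof (rule poly_mapping_eqI)
    fix \<mu>
    have "(\<Sum>f\<in>T. h (c f) * Poly_Mapping.lookup f \<mu>) = h (?a \<mu>)"
    proof -
      have "h (c f * \<iota> x) = h (c f) * x" for f x
        using h.scale[of x "c f"] by (simp add: mult.commute)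
      then show ?thesis by (simp add: h.sum)
    qed
    also have "h (?a \<mu>) = 0"
    proof (cases "\<mu> \<in> ?M")
      case True
      then show ?thesis using a0[OF True] by (simp add: h.zero)
    next
      case False
      then have "?a \<mu> = 0" by (intro sum.neutral) (auto simp: in_keys_iff \<iota>_zero)
      then show ?thesis by (simp add: h.zero)
    qed
    finally show "Poly_Mapping.lookup (\<Sum>f\<in>T. poly_scale (h (c f)) f) \<mu> = Poly_Mapping.lookup 0 \<mu>"
      by (simp add: lookup_sum)
  qed
  then have "h (c g) = 0" using mp.independentD[OF F(2) T, of "\<lambda>f. h (c f)"] g by blast
  then show False using h(2) by simp
qed

lemma dim_span_evaluate_image:
  fixes e :: "'v \<Rightarrow> 'b" and S :: "('v, 'k) mpoly set"
  assumes inf: "infinite (UNIV :: 'l set)" and B: "finite B" "inj_on e B"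
    and S: "S \<subseteq> carrier (coord_ring B)"
  shows "vector_space.dim fscale (module.span fscale ((evaluate \<iota> e B :: ('v, 'k) mpoly \<Rightarrow> ('b \<Rightarrow> 'l) \<Rightarrow> 'l) ` S))
    = vector_space.dim poly_scale S"
proof -
  let ?\<Phi> = "evaluate \<iota> e B :: ('v, 'k) mpoly \<Rightarrow> ('b \<Rightarrow> 'l) \<Rightarrow> 'l"
  interpret bc: base_change poly_scale fscale \<iota> ?\<Phi> by (rule base_change_evaluate)
  show ?thesis
  proof (rule bc.dim_span_image)
    fix F assume F: "F \<subseteq> S" "bc.A.independent F"
    note ind = evaluate_independent[OF inf B _ F(2)]
    have FB: "F \<subseteq> carrier (coord_ring B)" using F(1) S by blast
    have inj: "inj_on ?\<Phi> F"
    proof (rule inj_onI, rule ccontr)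
      fix f g assume fg: "f \<in> F" "g \<in> F" "?\<Phi> f = ?\<Phi> g" "f \<noteq> g"
      have "(if f = f then 1 else - 1 :: 'l) = 0"
        by (rule ind[of "{f, g}" "\<lambda>h. if h = f then 1 else - 1" f]) (use FB fg in auto)
      then show False by simp
    qed
    have "bc.A'.independent (?\<Phi> ` F)"
      unfolding bc.A'.dependent_explicit
    proof (intro notI, elim exE conjE bexE)
      fix t u w assume t: "finite t" "t \<subseteq> ?\<Phi> ` F" "(\<Sum>v\<in>t. fscale (u v) v) = 0" "w \<in> t" "u w \<noteq> 0"
      obtain T where T: "T \<subseteq> F" "t = ?\<Phi> ` T" "finite T"
        using t(1,2) by (meson finite_subset_image)
      obtain g where g: "g \<in> T" "w = ?\<Phi> g" using t(4) T(2) by blast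
      have "(\<Sum>f\<in>T. u (?\<Phi> f) * ?\<Phi> f v) = 0" for v
      proof -
        have "(\<Sum>f\<in>T. fscale (u (?\<Phi> f)) (?\<Phi> f)) = 0"
          using t(3) unfolding T(2) by (simp add: sum.reindex inj_on_subset[OF inj T(1)])
        then have "(\<Sum>f\<in>T. fscale (u (?\<Phi> f)) (?\<Phi> f)) v = 0" by (simp add: zero_fun_apply)
        then show ?thesis by (simp add: sum_fun_apply fscale_def)
      qed
      then have "u (?\<Phi> g) = 0" using ind[OF FB T(3,1) _ g(1), of "\<lambda>f. u (?\<Phi> f)"] by blast
      then show False using t(5) g(2) by simp
    qed
    then show "inj_on ?\<Phi> F \<and> bc.A'.independent (?\<Phi> ` F)" using inj by blast
  qed
qed

end


section \<open>Graded parts of a product of linear ideals\<close>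
interpretation mp: commutative_algebra "poly_scale :: 'k::field \<Rightarrow> ('v, 'k) mpoly \<Rightarrow> ('v, 'k) mpoly"
  by (rule commutative_algebra_poly_scale)

lemma monom_degree_eq_sum:
  assumes "finite M" "Poly_Mapping.keys \<mu> \<subseteq> M"
  shows "monom_degree \<mu> = (\<Sum>b\<in>M. Poly_Mapping.lookup \<mu> b)"
  unfolding monom_degree_def using assms
  by (intro sum.mono_neutral_left) (auto simp: in_keys_iff)

lemma monom_degree_add: "monom_degree (\<mu> + \<nu>) = monom_degree \<mu> + monom_degree \<nu>"
proof -
  let ?M = "Poly_Mapping.keys \<mu> \<union> Poly_Mapping.keys \<nu>"
  have "finite ?M" "Poly_Mapping.keys \<mu> \<subseteq> ?M" "Poly_Mapping.keys \<nu> \<subseteq> ?M" "Poly_Mapping.keys (\<mu> + \<nu>) \<subseteq> ?M"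
    using keys_add[of \<mu> \<nu>] by auto
  then show ?thesis by (simp add: monom_degree_eq_sum[of ?M] lookup_add sum.distrib)
qed

lemma monom_degree_single [simp]: "monom_degree (Poly_Mapping.single b n) = n"
  using monom_degree_eq_sum[of "{b}" "Poly_Mapping.single b n"] by simp

lemma keys_linear_form:
  assumes "\<mu> \<in> Poly_Mapping.keys (linear_form B \<phi>)"
  shows "\<exists>b\<in>B. \<mu> = Poly_Mapping.single b 1"
proof -
  have "\<mu> \<in> (\<Union>b\<in>B. Poly_Mapping.keys (Poly_Mapping.single (Poly_Mapping.single b 1) (\<phi> b)))"
    using assms keys_sum unfolding linear_form_def by fast
  then show ?thesis by (auto split: if_splits)
qed

lemma subspace_keys: "mp.subspace {p :: ('v, 'k::field) mpoly. \<forall>\<mu>\<in>Poly_Mapping.keys p. Q \<mu>}"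
proof (rule mp.subspaceI)
  fix p q :: "('v, 'k) mpoly" and c
  assume p: "p \<in> {p. \<forall>\<mu>\<in>Poly_Mapping.keys p. Q \<mu>}"
  show "poly_scale c p \<in> {p. \<forall>\<mu>\<in>Poly_Mapping.keys p. Q \<mu>}"
    using p by (auto simp: in_keys_iff)
  assume "q \<in> {p. \<forall>\<mu>\<in>Poly_Mapping.keys p. Q \<mu>}"
  then show "p + q \<in> {p. \<forall>\<mu>\<in>Poly_Mapping.keys p. Q \<mu>}"
    using p keys_add[of p q] by blast
qed simp

lemma carrier_coord_ring:
  "carrier (coord_ring B) = {p. \<forall>\<mu>\<in>Poly_Mapping.keys p. Poly_Mapping.keys \<mu> \<subseteq> B}"
  by (simp add: coord_ring_def)

lemma coord_ring_simps [simp]: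
  "x \<oplus>\<^bsub>coord_ring B\<^esub> y = x + y" "x \<otimes>\<^bsub>coord_ring B\<^esub> y = x * y" "\<zero>\<^bsub>coord_ring B\<^esub> = 0" "\<one>\<^bsub>coord_ring B\<^esub> = 1"
  by (simp_all add: coord_ring_def)

text \<open>
  In a sum of homogeneous pieces, the elements of degree \<open>d\<close> are those of the piece of degree \<open>d\<close>: all other
  pieces contribute nothing to the coefficients of the monomials of degree \<open>d\<close>.
\<close>
lemma graded_part_span:
  assumes sub: "\<And>d. mp.subspace (S d)" and deg: "\<And>d. S d \<subseteq> graded_part d UNIV"
  shows "graded_part d (mp.span (\<Union>d. S d)) = S d"
proof
  show "S d \<subseteq> graded_part d (mp.span (\<Union>d. S d))"
    using deg[of d] by (auto simp: graded_part_def intro: mp.span_base)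
  show "graded_part d (mp.span (\<Union>d. S d)) \<subseteq> S d"
  proof
    fix f assume f: "f \<in> graded_part d (mp.span (\<Union>d. S d))"
    then have "f \<in> mp.span (\<Union>d. S d)" by (simp add: graded_part_def)
    then have "\<exists>g\<in>S d. \<forall>\<mu>. monom_degree \<mu> = d \<longrightarrow> Poly_Mapping.lookup f \<mu> = Poly_Mapping.lookup g \<mu>"
    proof (induction rule: mp.span_induct_alt)
      case base
      then show ?case using mp.subspace_0[OF sub] by blast
    next
      case (step c x y)
      obtain e where e: "x \<in> S e" using step(1) by blast
      obtain g where g: "g \<in> S d" "\<forall>\<mu>. monom_degree \<mu> = d \<longrightarrow> Poly_Mapping.lookup y \<mu> = Poly_Mapping.lookup g \<mu>"
        using step.IH by blast
      show ?case
      proof (cases "e = d")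
        case True
        then show ?thesis using e g sub
          by (intro bexI[of _ "poly_scale c x + g"]) (auto simp: lookup_add intro: mp.subspace_add mp.subspace_scale)
      next
        case False
        have "x \<in> graded_part e UNIV" using deg e by blast
        then have "Poly_Mapping.lookup x \<mu> = 0" if "monom_degree \<mu> = d" for \<mu>
          using False that by (auto simp: graded_part_def in_keys_iff)
        then show ?thesis using g by (intro bexI[of _ g]) (auto simp: lookup_add)
      qed
    qed
    then obtain g where g: "g \<in> S d"
      "\<forall>\<mu>. monom_degree \<mu> = d \<longrightarrow> Poly_Mapping.lookup f \<mu> = Poly_Mapping.lookup g \<mu>" by blast
    have "f = g"
    proof (rule poly_mapping_eqI)
      fix \<mu>
      have "g \<in> graded_part d UNIV" using deg g(1) by blast
      then have "Poly_Mapping.lookup f \<mu> = 0 \<and> Poly_Mapping.lookup g \<mu> = 0" if "monom_degree \<mu> \<noteq> d"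
        using f that unfolding graded_part_def mem_Collect_eq by (metis in_keys_iff)
      then show "Poly_Mapping.lookup f \<mu> = Poly_Mapping.lookup g \<mu>"
        using g(2) by (cases "monom_degree \<mu> = d") simp_all
    qed
    then show "f \<in> S d" using g(1) by simp
  qed
qed

text \<open>The parameter \<open>K\<close> only serves to fix the type of the coefficients throughout.\<close>
context
  fixes B :: "'v set" and K :: "'k::field itself"
  assumes finite_B: "finite B"
begin

abbreviation R :: "('v, 'k) mpoly ring" where
  "R \<equiv> coord_ring B"

abbreviation LF :: "('v, 'k) mpoly set" where
  "LF \<equiv> range (linear_form B)"

lemma subspace_carrier: "mp.subspace (carrier R)"
  unfolding carrier_coord_ring by (rule subspace_keys)

lemma subspace_graded_part_carrier: "mp.subspace (graded_part d (carrier R))"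
proof -
  have "graded_part d (carrier R)
      = {p. \<forall>\<mu>\<in>Poly_Mapping.keys p. Poly_Mapping.keys \<mu> \<subseteq> B \<and> monom_degree \<mu> = d}"
    by (auto simp: graded_part_def carrier_coord_ring)
  then show ?thesis by (simp only: subspace_keys)
qed

lemma mult_in_graded_part_carrier:
  assumes "p \<in> graded_part d (carrier R)" "q \<in> graded_part e (carrier R)"
  shows "p * q \<in> graded_part (d + e) (carrier R)"
proof -
  interpret R: cring "R" by (rule cring_coord_ring)
  have "p * q \<in> carrier R"
    using R.m_closed[of p q] assms by (simp add: graded_part_def)
  moreover have "monom_degree \<mu> = d + e" if \<mu>: "\<mu> \<in> Poly_Mapping.keys (p * q)" for \<mu>
  proof -
    obtain \<alpha> \<beta> where "\<mu> = \<alpha> + \<beta>" "\<alpha> \<in> Poly_Mapping.keys p" "\<beta> \<in> Poly_Mapping.keys q"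
      using \<mu> keys_mult[of p q] by auto
    then show ?thesis using assms by (simp add: graded_part_def monom_degree_add)
  qed
  ultimately show ?thesis by (simp add: graded_part_def)
qed

lemma linear_form_in_graded_part: "linear_form B \<phi> \<in> graded_part 1 (carrier R)"
  using linear_form_in_carrier keys_linear_form unfolding graded_part_def by fastforce

lemma single_in_power_part:
  assumes "Poly_Mapping.keys \<mu> \<subseteq> B"
  shows "Poly_Mapping.single \<mu> c \<in> mp.power_part LF (monom_degree \<mu>)"
proof -
  have "Poly_Mapping.single \<mu> (1::'k) \<in> mp.power_part LF d"
    if "monom_degree \<mu> = d" for d
    using that assms
  proof (induction d arbitrary: \<mu>)
    case 0
    then have "\<mu> = 0"
      by (intro poly_mapping_eqI) (auto simp: monom_degree_def in_keys_iff)
    then show ?case by (simp add: mp.span_base)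
  next
    case (Suc d)
    then obtain b where b: "b \<in> Poly_Mapping.keys \<mu>"
      by (force simp: monom_degree_def)
    let ?\<nu> = "\<mu> - Poly_Mapping.single b 1"
    have \<mu>: "\<mu> = Poly_Mapping.single b 1 + ?\<nu>"
      using b by (intro poly_mapping_eqI) (auto simp: lookup_add lookup_minus lookup_single when_def in_keys_iff)
    have "monom_degree ?\<nu> = d"
      using Suc.prems(1) \<mu> monom_degree_add[of "Poly_Mapping.single b 1" ?\<nu>] by simp
    moreover have "Poly_Mapping.keys ?\<nu> \<subseteq> B"
      using Suc.prems(2) by (auto simp: in_keys_iff lookup_minus)
    ultimately have \<nu>: "Poly_Mapping.single ?\<nu> (1::'k) \<in> mp.power_part LF d"
      using Suc.IH by blast
    have "linear_form B (\<lambda>x. if x = b then 1 else 0)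
        = (\<Sum>x\<in>B. if x = b then Poly_Mapping.single (Poly_Mapping.single b 1) (1::'k) else 0)"
      unfolding linear_form_def by (intro sum.cong) auto
    also have "\<dots> = Poly_Mapping.single (Poly_Mapping.single b 1) 1"
      using finite_B b Suc.prems(2) by (simp add: subset_iff)
    finally have "Poly_Mapping.single \<mu> (1::'k)
        = linear_form B (\<lambda>x. if x = b then 1 else 0) * Poly_Mapping.single ?\<nu> 1"
      using \<mu> by (simp add: mult_single)
    then show ?case using \<nu> by (auto intro!: mp.mult_in_mult_span)
  qed
  then have "poly_scale c (Poly_Mapping.single \<mu> 1) \<in> mp.power_part LF (monom_degree \<mu>)"
    by (simp add: mp.subspace_scale)
  then show ?thesis by (simp add: poly_scale_def mult_single)
qed

lemma power_part_linear_form: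
  shows "mp.power_part LF d = graded_part d (carrier R)"
proof
  show "mp.power_part LF d \<subseteq> graded_part d (carrier R)"
  proof (induction d)
    case 0
    have "1 \<in> graded_part 0 (carrier R)"
      by (auto simp: graded_part_def carrier_coord_ring monom_degree_def)
    then show ?case using mp.span_minimal[OF _ subspace_graded_part_carrier] by simp
  next
    case (Suc d)
    have "mp.mult_span LF (mp.power_part LF d)
        \<subseteq> graded_part (1 + d) (carrier R)"
      by (rule mp.mult_span_subset[OF subspace_graded_part_carrier])
        (use Suc mult_in_graded_part_carrier[OF linear_form_in_graded_part] in blast)
    then show ?case by simp
  qed
  show "graded_part d (carrier R) \<subseteq> mp.power_part LF d"
  proof
    fix p :: "('v, 'k) mpoly" assume p: "p \<in> graded_part d (carrier R)"
    have "(\<Sum>\<mu>\<in>Poly_Mapping.keys p. Poly_Mapping.single \<mu> (Poly_Mapping.lookup p \<mu>))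
        \<in> mp.power_part LF d"
    proof (rule mp.subspace_sum[OF mp.subspace_power_part])
      fix \<mu> assume "\<mu> \<in> Poly_Mapping.keys p"
      then have "Poly_Mapping.keys \<mu> \<subseteq> B" "monom_degree \<mu> = d"
        using p by (auto simp: graded_part_def carrier_coord_ring)
      then show "Poly_Mapping.single \<mu> (Poly_Mapping.lookup p \<mu>) \<in> mp.power_part LF d"
        using single_in_power_part[of \<mu>] by blast
    qed
    then show "p \<in> mp.power_part LF d" using mpoly_sum_monomials[of p] by simp
  qed
qed

lemma carrier_eq_span_power_part:
  "carrier R = mp.span (\<Union>d. mp.power_part LF d)"
proof
  show "carrier R \<subseteq> mp.span (\<Union>d. mp.power_part LF d)"
  proof
    fix p :: "('v, 'k) mpoly" assume p: "p \<in> carrier R"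
    have "(\<Sum>\<mu>\<in>Poly_Mapping.keys p. Poly_Mapping.single \<mu> (Poly_Mapping.lookup p \<mu>))
        \<in> mp.span (\<Union>d. mp.power_part LF d)"
    proof (rule mp.span_sum, rule mp.span_base, rule UN_I[OF UNIV_I])
      fix \<mu> assume "\<mu> \<in> Poly_Mapping.keys p"
      then have "Poly_Mapping.keys \<mu> \<subseteq> B" using p by (auto simp: carrier_coord_ring)
      then show "Poly_Mapping.single \<mu> (Poly_Mapping.lookup p \<mu>) \<in> mp.power_part LF (monom_degree \<mu>)"
        by (rule single_in_power_part)
    qed
    then show "p \<in> mp.span (\<Union>d. mp.power_part LF d)"
      using mpoly_sum_monomials[of p] by simp
  qed
  show "mp.span (\<Union>d. mp.power_part LF d) \<subseteq> carrier R"
    by (rule mp.span_minimal[OF _ subspace_carrier])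
      (auto simp: power_part_linear_form graded_part_def)
qed

text \<open>
  A graded subspace is an ideal if it is closed under multiplication by linear forms, since these and the
  constants generate the ring.
\<close>
lemma ideal_span_graded:
  assumes sub: "\<And>d. mp.subspace (S d)" and carr: "\<And>d. S d \<subseteq> carrier R"
    and mult: "\<And>\<phi> s d. s \<in> S d \<Longrightarrow> linear_form B \<phi> * s \<in> S (Suc d)"
  shows "ideal (mp.span (\<Union>d. S d)) R"
proof -
  interpret R: cring R by (rule cring_coord_ring)
  let ?I = "mp.span (\<Union>d. S d)"
  have power: "p * s \<in> S (d + e)" if "p \<in> mp.power_part LF e" "s \<in> S d" for p s d e
    using that(1)
  proof (induction e arbitrary: p)
    case 0
    then obtain c where "p = poly_scale c 1"
      by (metis mp.power_part.simps(1) mp.span_singleton rangeE)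
    then have "p * s = poly_scale c s" by (simp add: mp.scale_mult[symmetric])
    then show ?case using that(2) sub by (simp add: mp.subspace_scale)
  next
    case (Suc e)
    have "mp.mult_span LF (mp.power_part LF e)
        \<subseteq> {p. p * s \<in> S (d + Suc e)}"
    proof (rule mp.mult_span_subset)
      show "mp.subspace {p. p * s \<in> S (d + Suc e)}"
        using sub by (intro mp.subspaceI)
          (auto simp: mp.subspace_0 distrib_right mp.subspace_add mp.scale_mult[symmetric] mp.subspace_scale)
      fix l g assume "l \<in> LF" "g \<in> mp.power_part LF e"
      then show "l * g \<in> {p. p * s \<in> S (d + Suc e)}"
        using mult[of "g * s" "d + e"] Suc.IH by (auto simp: mult.assoc)
    qed
    then show ?case using Suc.prems by auto
  qed
  have closed: "x * a \<in> ?I" if "x \<in> carrier R" "a \<in> ?I" for x a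
  proof -
    have x: "x \<in> mp.span (\<Union>d. mp.power_part LF d)"
      using that(1) carrier_eq_span_power_part by blast
    have "x * a \<in> mp.mult_span (mp.span (\<Union>d. mp.power_part LF d)) ?I"
      using x that(2) by (rule mp.mult_in_mult_span)
    also have "\<dots> \<subseteq> ?I"
      unfolding mp.mult_span_span
      by (rule mp.span_mono) (use power in blast)
    finally show ?thesis .
  qed
  have sub_carr: "?I \<subseteq> carrier R"
    using carr by (intro mp.span_minimal subspace_carrier) auto
  show ?thesis
  proof (rule idealI[OF R.ring_axioms])
    show "subgroup ?I (add_monoid R)"
    proof (rule R.add.subgroupI)
      show "\<ominus>\<^bsub>R\<^esub> a \<in> ?I" if a: "a \<in> ?I" for a
      proof -
        have "\<ominus>\<^bsub>R\<^esub> a = - a"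
        proof (rule R.minus_equality)
          show "- a \<in> carrier R"
            using a sub_carr mp.subspace_neg[OF subspace_carrier] by blast
        qed (use a sub_carr in auto)
        then show ?thesis using a by (simp add: mp.span_neg)
      qed
      show "?I \<noteq> {}" using mp.span_zero by blast
    qed (use sub_carr mp.span_add in auto)
    fix a x assume ax: "a \<in> ?I" "x \<in> carrier R"
    show "x \<otimes>\<^bsub>R\<^esub> a \<in> ?I" using closed[OF ax(2,1)] by simp
    then show "a \<otimes>\<^bsub>R\<^esub> x \<in> ?I" by (simp add: mult.commute)
  qed
qed

lemma subspace_ideal:
  assumes "ideal I R"
  shows "mp.subspace I"
proof -
  interpret ideal I R by (rule assms)
  show ?thesis
  proof (rule mp.subspaceI)
    show "0 \<in> I" using additive_subgroup.zero_closed[OF is_additive_subgroup] by simp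
    show "x + y \<in> I" if "x \<in> I" "y \<in> I" for x y
      using additive_subgroup.a_closed[OF is_additive_subgroup that] by simp
    show "poly_scale c x \<in> I" if "x \<in> I" for c x
      using I_l_closed[OF that, of "Poly_Mapping.single 0 c"]
      by (auto simp: poly_scale_def carrier_coord_ring)
  qed
qed

lemma product_part_subset_graded_part:
  assumes "\<And>i. i \<in> set is \<Longrightarrow> L i \<subseteq> LF"
  shows "mp.product_part LF L is d \<subseteq> graded_part d (carrier R)"
  using mp.product_part_subset_power_part[of "is" L LF d, OF assms] power_part_linear_form by blast

lemma ideal_span_product_part:
  assumes "\<And>i. i \<in> set is \<Longrightarrow> L i \<subseteq> LF"
  shows "ideal (mp.span (\<Union>d. mp.product_part LF L is d)) R"
proof (rule ideal_span_graded)
  show "mp.product_part LF L is d \<subseteq> carrier R" for d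
    using product_part_subset_graded_part[of "is" L d, OF assms] by (auto simp: graded_part_def)
qed (simp_all add: mp.mult_in_product_part)

text \<open>
  The elements \<open>a\<close> that multiply the product of the remaining ideals into the right-hand side form an ideal.
  It contains \<open>L i\<close> by construction, hence the ideal generated by \<open>L i\<close>.
\<close>
lemma foldr_ideal_prod_eq_span_product_part:
  assumes "\<And>i. i \<in> set is \<Longrightarrow> L i \<subseteq> LF"
  shows "foldr (ideal_prod R) (map (\<lambda>i. genideal R (L i)) is) (carrier R)
    = mp.span (\<Union>d. mp.product_part LF L is d)"
  using assms
proof (induction "is")
  case Nil
  show ?case using carrier_eq_span_power_part by simp
next
  case (Cons i "is")
  interpret R: cring R by (rule cring_coord_ring)
  let ?S = "\<lambda>is. mp.span (\<Union>d. mp.product_part LF L is d)"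
  have Li: "L i \<subseteq> carrier R"
    using Cons.prems linear_form_in_carrier by fastforce
  have idl: "ideal (?S is) R" "ideal (?S (i # is)) R"
    using Cons.prems by (intro ideal_span_product_part; simp)+
  interpret S: ideal "?S (i # is)" R by (rule idl(2))
  have gen: "ideal (genideal R (L i)) R" by (rule R.genideal_ideal[OF Li])
  have "ideal_prod R (genideal R (L i)) (?S is) = ?S (i # is)"
  proof
    have prod: "a * g \<in> ?S (i # is)" if a: "a \<in> genideal R (L i)" and g: "g \<in> ?S is" for a g
    proof -
      let ?Q = "{a \<in> carrier R. \<forall>g\<in>?S is. a * g \<in> ?S (i # is)}"
      have "ideal ?Q R"
      proof (rule idealI[OF R.ring_axioms])
        show "subgroup ?Q (add_monoid R)"
        proof (rule R.add.subgroupI)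
          show "\<ominus>\<^bsub>R\<^esub> a \<in> ?Q" if a: "a \<in> ?Q" for a
          proof -
            have "\<ominus>\<^bsub>R\<^esub> a = - a"
            proof (rule R.minus_equality)
              show "- a \<in> carrier R"
                using a mp.subspace_neg[OF subspace_carrier] by blast
            qed (use a in auto)
            then show ?thesis using a R.a_inv_closed[of a] by (auto intro: mp.span_neg)
          qed
          have "0 \<in> ?Q" using R.zero_closed by (simp add: mp.span_zero)
          then show "?Q \<noteq> {}" by blast
          show "a \<oplus>\<^bsub>R\<^esub> b \<in> ?Q" if "a \<in> ?Q" "b \<in> ?Q" for a b
            using that R.a_closed[of a b] by (auto simp: distrib_right intro: mp.span_add)
        qed blast
        fix a x assume ax: "a \<in> ?Q" "x \<in> carrier R"
        then have "x * (a * g) \<in> ?S (i # is)" if "g \<in> ?S is" for g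
          using S.I_l_closed[of "a * g" x] that by auto
        then show "x \<otimes>\<^bsub>R\<^esub> a \<in> ?Q"
          using ax R.m_closed[of x a] by (auto simp: mult.assoc)
        then show "a \<otimes>\<^bsub>R\<^esub> x \<in> ?Q" by (simp add: mult.commute)
      qed
      moreover have "L i \<subseteq> ?Q"
      proof
        fix l assume l: "l \<in> L i"
        have "l * g \<in> ?S (i # is)" if "g \<in> ?S is" for g
        proof -
          have "l * g \<in> mp.mult_span (mp.span (L i)) (?S is)"
            using l that by (intro mp.mult_in_mult_span) (auto intro: mp.span_base)
          also have "\<dots> \<subseteq> ?S (i # is)"
            unfolding mp.mult_span_span
          proof (rule mp.span_mono, clarify)
            fix l g d assume "l \<in> L i" "g \<in> mp.product_part LF L is d"
            then have "l * g \<in> mp.product_part LF L (i # is) (Suc d)"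
              by (simp add: mp.mult_in_mult_span)
            then show "l * g \<in> (\<Union>d. mp.product_part LF L (i # is) d)" by blast
          qed
          finally show ?thesis .
        qed
        then show "l \<in> ?Q" using l Li by blast
      qed
      ultimately have "genideal R (L i) \<subseteq> ?Q" by (rule R.genideal_minimal)
      then show ?thesis using a g by blast
    qed
    show "ideal_prod R (genideal R (L i)) (?S is) \<subseteq> ?S (i # is)"
    proof
      fix s assume "s \<in> ideal_prod R (genideal R (L i)) (?S is)"
      then show "s \<in> ?S (i # is)"
        by (induction rule: ideal_prod.induct) (simp_all add: prod mp.span_add del: mp.product_part.simps)
    qed
    let ?P = "ideal_prod R (genideal R (L i)) (?S is)"
    have subP: "mp.subspace ?P" by (rule subspace_ideal[OF R.ideal_prod_is_ideal[OF gen idl(1)]])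
    have "mp.product_part LF L (i # is) d \<subseteq> ?P" for d
    proof (cases d)
      case 0
      then show ?thesis using mp.subspace_0[OF subP] by simp
    next
      case (Suc e)
      have "mp.mult_span (L i) (mp.product_part LF L is e) \<subseteq> ?P"
      proof (rule mp.mult_span_subset[OF subP])
        fix l g assume "l \<in> L i" "g \<in> mp.product_part LF L is e"
        then have "l \<in> genideal R (L i)" "g \<in> ?S is"
          using R.genideal_self[OF Li] by (auto intro: mp.span_base)
        then show "l * g \<in> ?P" using ideal_prod.prod[of l _ g "?S is" R] by simp
      qed
      then show ?thesis using Suc by simp
    qed
    then show "?S (i # is) \<subseteq> ?P" by (intro mp.span_minimal[OF _ subP]) blast
  qed
  then show ?case using Cons by simp
qed

theorem graded_part_product_of_genideals:
  assumes "\<And>i. i \<in> set is \<Longrightarrow> L i \<subseteq> LF"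
  shows "graded_part d (foldr (ideal_prod R)
      (map (\<lambda>i. genideal R (L i)) is) (carrier R))
    = mp.product_part LF L is d"
proof -
  have "graded_part d (mp.span (\<Union>d. mp.product_part LF L is d)) = mp.product_part LF L is d"
  proof (rule graded_part_span)
    show "mp.product_part LF L is d \<subseteq> graded_part d UNIV" for d
      using product_part_subset_graded_part[of "is" L d, OF assms] by (auto simp: graded_part_def)
  qed simp
  then show ?thesis
    using foldr_ideal_prod_eq_span_product_part[of "is" L] assms by metis
qed

end


section \<open>Linear forms vanishing on intersections of subspaces\<close>
interpretation fn: vector_space "fscale :: 'k::field \<Rightarrow> ('x \<Rightarrow> 'k) \<Rightarrow> 'x \<Rightarrow> 'k"
  using commutative_algebra_fscale by (rule commutative_algebra.axioms(1))

context finite_dimensional_vector_space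
begin

definition dual :: "('b \<Rightarrow> 'a) set" where
  "dual = {\<phi>. Vector_Spaces.linear scale (*) \<phi>}"

definition common_zeros :: "('b \<Rightarrow> 'a) set \<Rightarrow> 'b set" where
  "common_zeros C = {v. \<forall>\<phi>\<in>C. \<phi> v = 0}"

lemma dual_add: "\<phi> \<in> dual \<Longrightarrow> \<phi> (v + w) = \<phi> v + \<phi> w"
  and dual_scale: "\<phi> \<in> dual \<Longrightarrow> \<phi> (scale c v) = c * \<phi> v"
  unfolding dual_def Vector_Spaces.linear_iff by auto

lemma dual_zero: "\<phi> \<in> dual \<Longrightarrow> \<phi> 0 = 0"
  using dual_scale[of \<phi> 0 0] by simp

lemma dual_diff: "\<phi> \<in> dual \<Longrightarrow> \<phi> (v - w) = \<phi> v - \<phi> w"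
  using dual_add[of \<phi> "v - w" w] by simp

lemma dual_sum: "\<phi> \<in> dual \<Longrightarrow> \<phi> (sum f M) = (\<Sum>i\<in>M. \<phi> (f i))"
  by (induction M rule: infinite_finite_induct) (simp_all add: dual_zero dual_add)

lemma subspace_dual: "fn.subspace dual"
proof (rule fn.subspaceI)
  show "0 \<in> dual" "\<And>x y. x \<in> dual \<Longrightarrow> y \<in> dual \<Longrightarrow> x + y \<in> dual"
    "\<And>c x. x \<in> dual \<Longrightarrow> fscale c x \<in> dual"
    using vector_space_axioms vector_space_field
    by (auto simp: dual_def Vector_Spaces.linear_iff fun_apply algebra_simps)
qed

lemma subspace_common_zeros: "C \<subseteq> dual \<Longrightarrow> subspace (common_zeros C)"
  unfolding common_zeros_def by (rule subspaceI) (auto simp: dual_zero dual_add dual_scale subset_iff)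

lemma common_zeros_span: "common_zeros (fn.span C) = common_zeros C"
proof
  show "common_zeros (fn.span C) \<subseteq> common_zeros C"
    using fn.span_superset[of C] by (auto simp: common_zeros_def)
  show "common_zeros C \<subseteq> common_zeros (fn.span C)"
  proof
    fix v assume v: "v \<in> common_zeros C"
    have "\<phi> v = 0" if "\<phi> \<in> fn.span C" for \<phi>
      using that by (induction rule: fn.span_induct_alt) (use v in \<open>auto simp: common_zeros_def fun_apply\<close>)
    then show "v \<in> common_zeros (fn.span C)" by (simp add: common_zeros_def)
  qed
qed

lemma dual_eq_sum_coordinates:
  assumes "\<phi> \<in> dual"
  shows "\<phi> = (\<Sum>b\<in>Basis. fscale (\<phi> b) (\<lambda>v. representation Basis v b))"
proof
  fix v
  have "\<phi> v = \<phi> (\<Sum>b\<in>Basis. scale (representation Basis v b) b)"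
    using sum_representation_eq[OF independent_Basis, of v Basis] span_Basis finite_Basis by simp
  also have "\<dots> = (\<Sum>b\<in>Basis. fscale (\<phi> b) (\<lambda>v. representation Basis v b) v)"
    by (simp add: dual_sum[OF assms] dual_scale[OF assms] fun_apply mult.commute)
  also have "\<dots> = (\<Sum>b\<in>Basis. fscale (\<phi> b) (\<lambda>v. representation Basis v b)) v"
    by (rule sum_fun_apply[symmetric])
  finally show "\<phi> v = (\<Sum>b\<in>Basis. fscale (\<phi> b) (\<lambda>v. representation Basis v b)) v" .
qed

lemma dual_subset_span: "dual \<subseteq> fn.span ((\<lambda>b v. representation Basis v b) ` Basis)"
proof
  fix \<phi> assume "\<phi> \<in> dual"
  then show "\<phi> \<in> fn.span ((\<lambda>b v. representation Basis v b) ` Basis)"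
    using dual_eq_sum_coordinates[of \<phi>]
    by (metis (no_types, lifting) fn.span_base fn.span_scale fn.span_sum image_eqI)
qed

text \<open>
  Every functional on the dual space is evaluation at a vector.
\<close>
lemma exists_common_zero_off_functional:
  assumes "fn.subspace U" "U \<subseteq> dual" "\<phi> \<in> dual" "\<phi> \<notin> U"
  shows "\<exists>y\<in>common_zeros U. \<phi> y \<noteq> 0"
proof -
  obtain h where h: "Vector_Spaces.linear fscale (*) h" "h \<phi> = 1" "\<forall>u\<in>U. h u = 0"
    using fn.exists_functional_separating[OF assms(1,4)] by blast
  interpret h: Vector_Spaces.linear fscale "(*)" h by (rule h(1))
  define y where "y = (\<Sum>b\<in>Basis. scale (h (\<lambda>v. representation Basis v b)) b)"
  have eval: "\<psi> y = h \<psi>" if "\<psi> \<in> dual" for \<psi>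
  proof -
    have "h \<psi> = h (\<Sum>b\<in>Basis. fscale (\<psi> b) (\<lambda>v. representation Basis v b))"
      using dual_eq_sum_coordinates[OF that] by (rule arg_cong)
    also have "\<dots> = \<psi> y"
      unfolding h.sum h.scale y_def dual_sum[OF that] dual_scale[OF that] by (simp add: mult.commute)
    finally show ?thesis ..
  qed
  have "y \<in> common_zeros U" using h(3) eval[OF subsetD[OF assms(2)]] by (simp add: common_zeros_def)
  moreover have "\<phi> y \<noteq> 0" using eval[OF assms(3)] h(2) by simp
  ultimately show ?thesis by blast
qed

text \<open>
  Each functional that is independent of the previous ones cuts the space of common zeros down by one dimension.
\<close>
lemma dim_common_zeros_add_card:
  assumes "finite C" "fn.independent C" "C \<subseteq> dual"
  shows "dim (common_zeros C) + card C = card Basis"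
  using assms
proof (induction C rule: finite_induct)
  case empty
  then show ?case by (simp add: common_zeros_def)
next
  case (insert c C)
  have ind: "fn.independent C" using insert.prems(1) fn.independent_mono by blast
  have "c \<notin> fn.span C" using insert.prems(1) insert.hyps(2) by (simp add: fn.independent_insert)
  moreover have "fn.span C \<subseteq> dual" using insert.prems(2) by (intro fn.span_minimal subspace_dual) auto
  ultimately obtain y where y: "y \<in> common_zeros C" "c y \<noteq> 0"
    using exists_common_zero_off_functional[OF fn.subspace_span, of C c] insert.prems(2)
    by (auto simp: common_zeros_span)
  let ?Z = "common_zeros (insert c C)"
  have sub: "subspace ?Z" "subspace (common_zeros C)"
    using insert.prems(2) by (auto intro: subspace_common_zeros)
  have "common_zeros C \<subseteq> span (insert y ?Z)"
  proof
    fix v assume v: "v \<in> common_zeros C"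
    let ?w = "v - scale (c v / c y) y"
    have "?w \<in> common_zeros C" using v y(1) sub(2) by (simp add: subspace_diff subspace_scale)
    moreover have "c ?w = 0"
      using insert.prems(2) y(2) by (simp add: dual_diff dual_scale)
    ultimately have "?w \<in> ?Z" by (simp add: common_zeros_def)
    then show "v \<in> span (insert y ?Z)" unfolding span_insert using span_base by blast
  qed
  moreover have "insert y ?Z \<subseteq> common_zeros C" using y(1) by (auto simp: common_zeros_def)
  ultimately have "dim (common_zeros C) = dim (insert y ?Z)"
    by (metis dim_span sub(2) span_eq_iff span_mono span_span subset_antisym)
  moreover have "y \<notin> ?Z" using y(2) by (simp add: common_zeros_def)
  ultimately have "dim (common_zeros C) = dim ?Z + 1"
    using sub(1) by (simp add: dim_insert span_eq_iff[THEN iffD2])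
  moreover have "dim (common_zeros C) + card C = card Basis"
    using insert.IH[OF ind] insert.prems(2) by simp
  ultimately show ?case using insert.hyps by simp
qed

lemma linear_linear_form:
  "Vector_Spaces.linear fscale poly_scale (linear_form Basis :: ('b \<Rightarrow> 'a) \<Rightarrow> ('b, 'a) mpoly)"
  unfolding Vector_Spaces.linear_iff
proof (intro conjI allI fn.vector_space_axioms vector_space_poly_scale)
  show "linear_form Basis (x + y) = linear_form Basis x + linear_form Basis y" for x y :: "'b \<Rightarrow> 'a"
    by (simp add: linear_form_def fun_apply single_add sum.distrib)
  show "linear_form Basis (fscale c x) = poly_scale c (linear_form Basis x)" for c and x :: "'b \<Rightarrow> 'a"
    by (simp add: linear_form_def fun_apply poly_scale_def sum_distrib_left mult_single)
qed

lemma lookup_linear_form: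
  "b \<in> Basis \<Longrightarrow> Poly_Mapping.lookup (linear_form Basis \<phi>) (Poly_Mapping.single b 1) = \<phi> b"
proof -
  assume b: "b \<in> Basis"
  have "Poly_Mapping.lookup (linear_form Basis \<phi>) (Poly_Mapping.single b 1)
      = (\<Sum>x\<in>Basis. if x = b then \<phi> x else 0)"
    unfolding linear_form_def lookup_sum
    by (intro sum.cong) (auto simp: lookup_single when_def dest: arg_cong[of _ _ Poly_Mapping.keys])
  then show ?thesis using b finite_Basis by simp
qed

lemma inj_on_linear_form_dual: "inj_on (linear_form Basis) dual"
proof (rule inj_onI)
  fix \<phi> \<psi> :: "'b \<Rightarrow> 'a" assume "\<phi> \<in> dual" "\<psi> \<in> dual" and eq: "linear_form Basis \<phi> = linear_form Basis \<psi>"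
  moreover have "\<phi> b = \<psi> b" if "b \<in> Basis" for b
    using lookup_linear_form[OF that, of \<phi>] lookup_linear_form[OF that, of \<psi>] eq by simp
  then have "(\<Sum>b\<in>Basis. fscale (\<phi> b) (\<lambda>v. representation Basis v b))
      = (\<Sum>b\<in>Basis. fscale (\<psi> b) (\<lambda>v. representation Basis v b))"
    by (intro sum.cong) auto
  ultimately show "\<phi> = \<psi>" using dual_eq_sum_coordinates by metis
qed

definition annihilator :: "'b set \<Rightarrow> ('b \<Rightarrow> 'a) set" where
  "annihilator W = {\<phi> \<in> dual. \<forall>w\<in>W. \<phi> w = 0}"

lemma common_zeros_Union_annihilator:
  assumes "\<And>i. i \<in> A \<Longrightarrow> subspace (V i)"
  shows "common_zeros (\<Union>i\<in>A. annihilator (V i)) = (\<Inter>i\<in>A. V i)"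
proof
  show "common_zeros (\<Union>i\<in>A. annihilator (V i)) \<subseteq> (\<Inter>i\<in>A. V i)"
  proof (intro subsetI INT_I, rule ccontr)
    fix v i assume v: "v \<in> common_zeros (\<Union>i\<in>A. annihilator (V i))" and i: "i \<in> A" "v \<notin> V i"
    obtain \<phi> where "Vector_Spaces.linear scale (*) \<phi>" "\<phi> v = 1" "\<forall>u\<in>V i. \<phi> u = 0"
      using exists_functional_separating[OF assms[OF i(1)] i(2)] by blast
    moreover from this have "\<phi> \<in> annihilator (V i)" by (simp add: annihilator_def dual_def)
    then have "\<phi> v = 0" using v i(1) by (auto simp: common_zeros_def)
    ultimately show False by simp
  qed
qed (auto simp: common_zeros_def annihilator_def)

text \<open>
  The sum of the annihilators of the \<open>V i\<close> has \<open>\<Inter>\<^sub>i\<^sub>\<in>\<^sub>A V i\<close> as its space of common zeros, so its dimension is the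
  codimension of this intersection.
\<close>
lemma dim_linear_forms_add_dim_Inter:
  assumes "\<And>i. i \<in> A \<Longrightarrow> subspace (V i)"
  shows "mp.dim (linear_form Basis ` (\<Union>i\<in>A. annihilator (V i))) + dim (\<Inter>i\<in>A. V i) = card Basis"
proof -
  let ?N = "\<Union>i\<in>A. annihilator (V i)"
  interpret LF: Vector_Spaces.linear fscale poly_scale "linear_form Basis :: ('b \<Rightarrow> 'a) \<Rightarrow> ('b, 'a) mpoly"
    by (rule linear_linear_form)
  have N: "?N \<subseteq> dual" by (auto simp: annihilator_def)
  obtain C where C: "C \<subseteq> ?N" "fn.independent C" "?N \<subseteq> fn.span C"
    using fn.maximal_independent_subset by blast
  have "finite C"
    using fn.independent_span_bound[OF _ C(2)] dual_subset_span C(1) N finite_Basis by blast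
  then have "dim (common_zeros C) + card C = card Basis"
    using dim_common_zeros_add_card C N by blast
  moreover have "common_zeros C = (\<Inter>i\<in>A. V i)"
  proof -
    have "fn.span C = fn.span ?N" using C by (metis fn.span_mono fn.span_span subset_antisym)
    then have "common_zeros C = common_zeros ?N"
      using common_zeros_span[of C] common_zeros_span[of ?N] by simp
    then show ?thesis using common_zeros_Union_annihilator[of A V] assms by simp
  qed
  moreover have "mp.dim (linear_form Basis ` ?N) = card C"
  proof -
    have span: "fn.span C \<subseteq> dual" using C(1) N by (intro fn.span_minimal subspace_dual) auto
    have inj: "inj_on (linear_form Basis) (fn.span C)" using inj_on_subset[OF inj_on_linear_form_dual span] .
    then have "mp.independent (linear_form Basis ` C)" using C(2) by (rule LF.independent_injective_image[rotated])
    moreover have "linear_form Basis ` ?N \<subseteq> mp.span (linear_form Basis ` C)"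
      unfolding LF.span_image using C(3) by blast
    ultimately have "card (linear_form Basis ` C) = mp.dim (linear_form Basis ` ?N)"
      using C(1) by (intro mp.basis_card_eq_dim) auto
    moreover have "inj_on (linear_form Basis) C" using inj inj_on_subset fn.span_superset by blast
    ultimately show ?thesis by (simp add: card_image)
  qed
  ultimately show ?thesis by simp
qed

end

section \<open>The Hilbert series of a product of linear ideals\<close>
text \<open>
  Extending the coefficients and numbering the variables turns an arrangement into one over an infinite field in
  \<open>n\<close> numbered variables, with the same Hilbert function and with ranks given by the codimensions of the
  intersections.  In this form two arrangements in different vector spaces can be compared.
\<close>
lemma exists_arrangement_over_extension:
  fixes \<iota> :: "'k::field \<Rightarrow> 'l::field" and scale :: "'k \<Rightarrow> 'v::ab_group_add \<Rightarrow> 'v"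
    and E :: "((nat \<Rightarrow> 'l) \<Rightarrow> 'l) set"
  assumes "coefficient_extension \<iota>" and "polynomial_functions {..<n} E"
    and "finite_dimensional_vector_space scale B" and "card B = n"
    and "\<And>i. i \<in> {1..m} \<Longrightarrow> module.subspace scale (V i)"
  shows "\<exists>L. polynomial_functions.arrangement E L {1..m} \<and>
    (\<forall>A\<subseteq>{1..m}. fn.dim (\<Union>i\<in>A. L i) + vector_space.dim scale (\<Inter>i\<in>A. V i) = n) \<and>
    (\<forall>d. mp.dim (graded_part d (product_ideal scale B m V))
      = fn.dim (commutative_algebra.product_part fscale (polynomial_functions.forms E) L [1..<Suc m] d))"
proof -
  interpret coefficient_extension \<iota> by (rule assms(1))
  interpret pf: polynomial_functions "{..<n}" E by (rule assms(2))
  interpret V: finite_dimensional_vector_space scale B by (rule assms(3))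
  obtain e where e: "bij_betw e B {..<n}"
    using ex_bij_betw_finite_nat[OF V.finite_Basis] assms(4) by (auto simp: atLeast0LessThan)
  let ?\<Phi> = "evaluate \<iota> e B :: ('v, 'k) mpoly \<Rightarrow> (nat \<Rightarrow> 'l) \<Rightarrow> 'l"
  interpret bc: base_change poly_scale fscale \<iota> ?\<Phi> by (rule base_change_evaluate)
  have inj: "inj_on e B" using e by (rule bij_betw_imp_inj_on)
  define N where "N = (\<lambda>i. linear_form B ` V.annihilator (V i))"
  define L where "L = (\<lambda>i. fn.span (?\<Phi> ` N i))"
  have dim_image: "fn.dim (fn.span (?\<Phi> ` S)) = mp.dim S" if "S \<subseteq> carrier (coord_ring B)" for S
    using dim_span_evaluate_image[OF pf.infinite_field V.finite_Basis inj that] .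
  have eval_form: "?\<Phi> (linear_form B \<phi>) = (\<Sum>b\<in>B. fscale (\<iota> (\<phi> b)) (\<lambda>v. v (e b)))" for \<phi>
  proof
    fix v :: "nat \<Rightarrow> 'l"
    have "(\<Prod>x\<in>B. v (e x) ^ Poly_Mapping.lookup (Poly_Mapping.single b (1::nat)) x) = v (e b)" if "b \<in> B" for b
    proof -
      have "(\<Prod>x\<in>B. v (e x) ^ Poly_Mapping.lookup (Poly_Mapping.single b (1::nat)) x)
          = (\<Prod>x\<in>B. if x = b then v (e x) else 1)"
        by (intro prod.cong) (auto simp: lookup_single when_def)
      then show ?thesis using that V.finite_Basis by simp
    qed
    then have "?\<Phi> (linear_form B \<phi>) v = (\<Sum>b\<in>B. \<iota> (\<phi> b) * v (e b))"
      by (simp add: linear_form_def evaluate_sum evaluate_single)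
    also have "\<dots> = (\<Sum>b\<in>B. fscale (\<iota> (\<phi> b)) (\<lambda>v. v (e b))) v"
      by (simp add: sum_fun_apply fun_apply)
    finally show "?\<Phi> (linear_form B \<phi>) v = (\<Sum>b\<in>B. fscale (\<iota> (\<phi> b)) (\<lambda>v. v (e b))) v" .
  qed
  have coord: "(\<lambda>v. v (e b)) \<in> E" if "b \<in> B" for b
    using that e by (auto simp: pf.E_eq bij_betw_def)
  have forms: "fn.span (?\<Phi> ` range (linear_form B)) = pf.forms"
  proof
    have "?\<Phi> (linear_form B \<phi>) \<in> fn.span E" for \<phi>
      unfolding eval_form by (intro fn.span_sum fn.span_scale fn.span_base coord)
    then show "fn.span (?\<Phi> ` range (linear_form B)) \<subseteq> pf.forms"
      unfolding pf.forms_def by (intro fn.span_minimal) auto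
    have "E \<subseteq> ?\<Phi> ` range (linear_form B)"
    proof
      fix f assume "f \<in> E"
      then have "f \<in> (\<lambda>b v. v b) ` e ` B"
        using bij_betw_imp_surj_on[OF e] by (simp add: pf.E_eq)
      then obtain b where b: "b \<in> B" "f = (\<lambda>v. v (e b))" by blast
      have "?\<Phi> (linear_form B (\<lambda>x. if x = b then 1 else 0))
          = (\<Sum>x\<in>B. if x = b then f else 0)"
        unfolding eval_form by (intro sum.cong) (auto simp: b(2) \<iota>_one \<iota>_zero fun_eq_iff fun_apply)
      also have "\<dots> = f" using b(1) V.finite_Basis by simp
      finally show "f \<in> ?\<Phi> ` range (linear_form B)" by blast
    qed
    then show "pf.forms \<subseteq> fn.span (?\<Phi> ` range (linear_form B))"
      unfolding pf.forms_def by (rule fn.span_mono)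
  qed
  have N_sub: "N i \<subseteq> range (linear_form B)" for i by (auto simp: N_def)
  have N_carr: "N i \<subseteq> carrier (coord_ring B)" for i
    unfolding N_def using linear_form_in_carrier by blast
  have "pf.arrangement L {1..m}"
    unfolding pf.arrangement_def L_def forms[symmetric]
    using fn.span_mono[OF image_mono[OF N_sub]] by auto
  moreover have "fn.dim (\<Union>i\<in>A. L i) + V.dim (\<Inter>i\<in>A. V i) = n" if A: "A \<subseteq> {1..m}" for A
  proof -
    have "fn.span (\<Union>i\<in>A. L i) = fn.span (?\<Phi> ` (\<Union>i\<in>A. N i))"
    proof
      have "L i \<subseteq> fn.span (?\<Phi> ` (\<Union>i\<in>A. N i))" if "i \<in> A" for i
        unfolding L_def by (rule fn.span_mono) (use that in blast)
      then show "fn.span (\<Union>i\<in>A. L i) \<subseteq> fn.span (?\<Phi> ` (\<Union>i\<in>A. N i))"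
        by (intro fn.span_minimal) auto
      have "?\<Phi> ` N i \<subseteq> L i" for i unfolding L_def by (rule fn.span_superset)
      then show "fn.span (?\<Phi> ` (\<Union>i\<in>A. N i)) \<subseteq> fn.span (\<Union>i\<in>A. L i)"
        by (intro fn.span_mono) blast
    qed
    then have "fn.dim (\<Union>i\<in>A. L i) = fn.dim (fn.span (?\<Phi> ` (\<Union>i\<in>A. N i)))"
      by (metis fn.dim_span)
    also have "\<dots> = mp.dim (\<Union>i\<in>A. N i)" using N_carr by (intro dim_image) blast
    also have "(\<Union>i\<in>A. N i) = linear_form B ` (\<Union>i\<in>A. V.annihilator (V i))"
      by (auto simp: N_def)
    finally have "fn.dim (\<Union>i\<in>A. L i) = mp.dim (linear_form B ` (\<Union>i\<in>A. V.annihilator (V i)))" .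
    moreover have "V.subspace (V i)" if "i \<in> A" for i using that A assms(5) by blast
    ultimately show ?thesis using V.dim_linear_forms_add_dim_Inter[of A V] assms(4) by simp
  qed
  moreover have "mp.dim (graded_part d (product_ideal scale B m V))
      = fn.dim (pf.product_part pf.forms L [1..<Suc m] d)" for d
  proof -
    have gens: "linear_ideal scale B W = genideal (coord_ring B) (linear_form B ` V.annihilator W)" for W
      unfolding linear_ideal_def V.annihilator_def V.dual_def
      by (rule arg_cong[where f = "genideal (coord_ring B)"]) auto
    have graded: "graded_part d (product_ideal scale B m V)
        = mp.product_part (range (linear_form B)) N [1..<Suc m] d"
      unfolding product_ideal_def gens N_def
      by (rule graded_part_product_of_genideals[OF V.finite_Basis]) auto
    have "mp.product_part (range (linear_form B)) N [1..<Suc m] d \<subseteq> carrier (coord_ring B)"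
      using product_part_subset_graded_part[OF V.finite_Basis, of "[1..<Suc m]" N d] N_sub
      by (auto simp: graded_part_def)
    then have "mp.dim (graded_part d (product_ideal scale B m V))
        = fn.dim (fn.span (?\<Phi> ` mp.product_part (range (linear_form B)) N [1..<Suc m] d))"
      unfolding graded by (rule dim_image[symmetric])
    then show ?thesis
      unfolding bc.product_part_image[symmetric] forms L_def .
  qed
  ultimately show ?thesis by blast
qed

lemma coefficient_extension_rational_functions:
  "coefficient_extension (\<lambda>c :: 'k::field. to_fract [:c:])"
proof
  fix x y :: 'k
  show "to_fract [:x + y:] = to_fract [:x:] + to_fract [:y:]" by (simp flip: to_fract_add)
  show "to_fract [:x * y:] = to_fract [:x:] * to_fract [:y:]" by (simp flip: to_fract_mult)
  show "to_fract [:1 :: 'k:] = 1" by (metis one_pCons to_fract_1)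
qed

lemma infinite_rational_functions: "infinite (UNIV :: 'k::field poly fract set)"
proof
  assume "finite (UNIV :: 'k poly fract set)"
  moreover have "inj (\<lambda>n. to_fract (monom (1::'k) n))"
    by (rule injI) (metis degree_monom_eq to_fract_eq_iff zero_neq_one)
  ultimately show False using finite_imageD finite_subset subset_UNIV infinite_UNIV_nat by blast
qed

theorem corollary4p2:
  fixes scale :: "'k::field \<Rightarrow> 'v::ab_group_add \<Rightarrow> 'v"
    and scale' :: "'k \<Rightarrow> 'w::ab_group_add \<Rightarrow> 'w"
    and B :: "'v set" and B' :: "'w set"
    and V :: "nat \<Rightarrow> 'v set" and V' :: "nat \<Rightarrow> 'w set"
    and m :: nat
  assumes "finite_dimensional_vector_space scale B"
    and "finite_dimensional_vector_space scale' B'"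
    and "vector_space.dim scale UNIV > 0"
    and "vector_space.dim scale' UNIV > 0"
    and "m \<ge> 1"
    and "\<And>i. i \<in> {1..m} \<Longrightarrow> module.subspace scale (V i)"
    and "\<And>i. i \<in> {1..m} \<Longrightarrow> module.subspace scale' (V' i)"
    and "\<And>S. S \<subseteq> {1..m} \<Longrightarrow>
           vector_space.dim scale (\<Inter>i\<in>S. V i) = vector_space.dim scale' (\<Inter>i\<in>S. V' i)"
  shows "hilbert_series (product_ideal scale B m V) = hilbert_series (product_ideal scale' B' m V')"
proof -
  interpret V: finite_dimensional_vector_space scale B by (rule assms(1))
  interpret V': finite_dimensional_vector_space scale' B' by (rule assms(2))
  define n where "n = card B"
  have n': "card B' = n" using assms(8)[of "{}"] by (simp add: n_def)
  define E where "E = (\<lambda>b (v :: nat \<Rightarrow> 'k poly fract). v b) ` {..<n}"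
  have pf: "polynomial_functions {..<n} E"
    by standard (simp_all add: E_def infinite_rational_functions)
  interpret pf: polynomial_functions "{..<n}" E by (rule pf)
  note extend = exists_arrangement_over_extension[OF coefficient_extension_rational_functions pf]
  obtain L where L: "pf.arrangement L {1..m}"
    "\<And>A. A \<subseteq> {1..m} \<Longrightarrow> fn.dim (\<Union>i\<in>A. L i) + V.dim (\<Inter>i\<in>A. V i) = n"
    "\<And>d. mp.dim (graded_part d (product_ideal scale B m V)) = fn.dim (pf.product_part pf.forms L [1..<Suc m] d)"
    using extend[of scale B m V, OF assms(1) n_def[symmetric] assms(6)] by blast
  obtain L' where L': "pf.arrangement L' {1..m}"
    "\<And>A. A \<subseteq> {1..m} \<Longrightarrow> fn.dim (\<Union>i\<in>A. L' i) + V'.dim (\<Inter>i\<in>A. V' i) = n"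
    "\<And>d. mp.dim (graded_part d (product_ideal scale' B' m V')) = fn.dim (pf.product_part pf.forms L' [1..<Suc m] d)"
    using extend[of scale' B' m V', OF assms(2) n' assms(7)] by blast
  have set: "set [1..<Suc m] = {1..m}" by auto
  have "fn.dim (\<Union>i\<in>A. L i) = fn.dim (\<Union>i\<in>A. L' i)" if "A \<subseteq> {1..m}" for A
    using L(2)[OF that] L'(2)[OF that] assms(8)[OF that] by simp
  then have "fn.dim (pf.product_part pf.forms L [1..<Suc m] d)
      = fn.dim (pf.product_part pf.forms L' [1..<Suc m] d)" for d
    using L(1) L'(1) by (intro pf.dim_product_part_cong) (simp_all only: set distinct_upt)
  then show ?thesis unfolding hilbert_series_def L(3) L'(3) by simp
qed

end
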